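(* Let $n\ge2$, let $1\le p\le q\le np/(n-p)<\infty$ and $\beta\in\mathbb{R}$. If $G\subset\mathbb{R}^n$ is a non-empty open set with non-empty boundary and $$\overline{\dim}_A(G^c)<\min\Bigl\{\frac{q}{p}(n-p+\beta),\ n-1\Bigr\},$$ then $G$ admits a $(q,p,\beta)$-Hardy--Sobolev inequality.
   Context: $G^c=\mathbb{R}^n\setminus G$, $\delta_{\partial G}(x)=\operatorname{dist}(x,\partial G)$, and $C_0^\infty(G)$ denotes smooth functions with compact support in $G$. The condition $np/(n-p)<\infty$ means in particular that $p<n$. An open set $G$ admits a $(q,p,\beta)$-Hardy--Sobolev inequality if there is a constant $C>0$ such that $$\biggl(\int_{G} |f|^q \,\delta_{\partial G}^{(q/p)(n-p+\beta)-n}\,dx\biggr)^{1/q}\le C \biggl(\int_G |\nabla f|^p\,\delta_{\partial G}^{\beta}\,dx\biggr)^{1/p}$$ for all $f\in C_0^\infty(G)$. For bounded $A\subset\mathbb{R}^n$ and $r>0$, $N(A,r)$ is the minimal number of open balls of radius $r$ centered at points of $A$ needed to cover $A$. $B(x,R)$ is the open ball and $d(E)$ the diameter of $E$. The (upper) Assouad dimension is $\overline{\dim}_A(E)=\inf\{\lambda\ge 0:\ \exists\, C_\lambda>0 \text{ such that } N(E\cap B(x,R),r)\le C_\lambda (r/R)^{-\lambda}\text{ for all } x\in E,\ 0<r<R<d(E)\}$. *)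

theory Defs
  imports "HOL-Analysis.Analysis"
begin

section \<open>Upper Assouad dimension\<close>

text \<open>
  The minimum is attained for totally bounded \<open>A\<close>, in particular for the bounded subsets of a
  Euclidean space to which it is applied below.
\<close>
definition covering_number :: "'a::metric_space set \<Rightarrow> real \<Rightarrow> nat" where
  "covering_number A r = (LEAST k. \<exists>F. F \<subseteq> A \<and> finite F \<and> card F = k \<and> A \<subseteq> (\<Union>y\<in>F. ball y r))"

text \<open>The library's \<open>diameter\<close> is meaningful for bounded sets only; here unbounded sets have
  infinite diameter.\<close>
definition ext_diameter :: "'a::metric_space set \<Rightarrow> ereal" where
  "ext_diameter E = (if bounded E then ereal (diameter E) else \<infinity>)"

text \<open>
  The infimum is a real one; the set is bounded below by \<open>0\<close> and contains the dimension of the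
  Euclidean space, so that it is never empty. For sets with at most one point the condition on
  \<open>R\<close> is void and the dimension is \<open>0\<close>.
\<close>
definition upper_assouad_dim :: "'a::euclidean_space set \<Rightarrow> real" where
  "upper_assouad_dim E = Inf {l. 0 \<le> l \<and>
     (\<exists>C>0. \<forall>x\<in>E. \<forall>r R. 0 < r \<and> r < R \<and> ereal R < ext_diameter E \<longrightarrow>
        real (covering_number (E \<inter> ball x R) r) \<le> C * (r / R) powr (- l))}"

section \<open>Test functions\<close>

text \<open>\<open>times_differentiable k f\<close> says that \<open>f\<close> is of class \<open>C\<^sup>k\<close> on the whole space.\<close>
fun times_differentiable :: "nat \<Rightarrow> ('a::euclidean_space \<Rightarrow> real) \<Rightarrow> bool" where
  "times_differentiable 0 f \<longleftrightarrow> continuous_on UNIV f"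
| "times_differentiable (Suc k) f \<longleftrightarrow> (\<forall>x. f differentiable (at x)) \<and>
     (\<forall>v. times_differentiable k (\<lambda>x. frechet_derivative f (at x) v))"

definition smooth :: "('a::euclidean_space \<Rightarrow> real) \<Rightarrow> bool" where
  "smooth f \<longleftrightarrow> (\<forall>k. times_differentiable k f)"

text \<open>Functions in \<open>C\<^sub>0\<^sup>\<infinity>(G)\<close> are identified with their extensions by zero to the whole space.\<close>
definition test_functions :: "'a::euclidean_space set \<Rightarrow> ('a \<Rightarrow> real) set" where
  "test_functions G = {f. smooth f \<and> compact (closure {x. f x \<noteq> 0}) \<and> closure {x. f x \<noteq> 0} \<subseteq> G}"

definition gradient :: "(real^'n \<Rightarrow> real) \<Rightarrow> real^'n \<Rightarrow> real^'n" where
  "gradient f x = (\<chi> i. frechet_derivative f (at x) (axis i 1))"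

section \<open>The Hardy--Sobolev inequality\<close>

text \<open>
  For \<open>f\<close> in \<open>test_functions G\<close> with \<open>G\<close> open, and for \<open>p, q > 0\<close>, both integrands are continuous
  on \<open>G\<close> with compact support in \<open>G\<close>, since the distance to the boundary is positive on \<open>G\<close>.
  Hence both integrals exist and are finite. The inequality is only considered for sets with
  non-empty boundary, as \<open>infdist x {} = 0\<close>.
\<close>
definition hardy_sobolev :: "real \<Rightarrow> real \<Rightarrow> real \<Rightarrow> (real^'n) set \<Rightarrow> bool" where
  "hardy_sobolev q p \<beta> G \<longleftrightarrow> (\<exists>C>0. \<forall>f\<in>test_functions G.
     (LINT x:G|lborel. \<bar>f x\<bar> powr q *
        infdist x (frontier G) powr (q / p * (real CARD('n) - p + \<beta>) - real CARD('n))) powr (1 / q)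
     \<le> C * (LINT x:G|lborel. norm (gradient f x) powr p *
        infdist x (frontier G) powr \<beta>) powr (1 / p))"

end

theory Submission
  imports Defs
begin

text \<open>
  Write \<open>E = - G\<close>, let \<open>\<delta>\<close> be the distance to \<open>E\<close> and \<open>n\<close> the dimension, and put
  \<open>a = (q/p) (n - p + \<beta>)\<close>, so that the weight on the left is \<open>\<delta> powr (a - n)\<close>. The hypothesis provides
  some \<open>d < min a (n - 1)\<close> such that \<open>E\<close> is covered at all scales as a set of dimension \<open>d\<close>
  (\<open>upper_assouad_dim_less_imp_cover\<close>).

  The condition \<open>d < n - 1\<close> is a statement about visibility: a point \<open>x\<close> off \<open>E\<close> can move to infinity
  along at least half of all rays without ever getting closer to \<open>E\<close> than \<open>c * \<delta> x\<close>
  (\<open>few_bad_directions\<close>), since at distance \<open>2 ^ j * \<delta> x\<close> the obstacles number at most a constant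
  times \<open>(2 ^ j / c) powr d\<close> and each of them blocks a share of order \<open>(c / 2 ^ j) powr (n - 1)\<close> of the
  directions. Integrating the gradient along these rays only, one obtains for \<open>f\<close> of class \<open>C\<^sup>1\<close> with
  compact support off \<open>E\<close> the bound of \<open>\<bar>f x\<bar>\<close> by a Riesz potential of the gradient that is restricted to
  the points \<open>y\<close> with \<open>c * \<delta> x \<le> \<delta> y\<close> (\<open>pointwise_bound\<close>). Seen from \<open>y\<close>, this restriction confines \<open>x\<close>
  to a neighbourhood of \<open>E\<close> of width comparable with \<open>\<delta> y\<close>, whose weighted measure grows at large radii
  \<open>\<rho>\<close> like \<open>\<rho> powr d\<close> only; here \<open>d < a\<close> makes the weight integrable up to \<open>E\<close>. As \<open>d < n - 1\<close>, the
  kernel \<open>dist x y powr (1 - n)\<close> is then integrable at infinity as well as at \<open>y\<close>, with the size that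
  scaling dictates, whatever the sign of the exponents (\<open>riesz_potential_bound\<close>).

  For \<open>p = 1\<close> and exponents \<open>1 \<le> Q \<le> n / (n - 1)\<close> this yields a weak type inequality by Fubini. Since the
  pointwise bound for the set \<open>{2 * b \<le> \<bar>f\<bar>}\<close> only uses the gradient where \<open>b < \<bar>f\<bar> < 2 * b\<close>, the weak
  type inequalities for dyadic \<open>b\<close> can be added up to the strong one, including the endpoint
  \<open>Q = n / (n - 1)\<close> (\<open>strong_type_bound\<close>). Applying the case \<open>p = 1\<close> to the signed power of \<open>f\<close> with
  exponent \<open>s = 1 + q (p - 1) / p\<close> and Hoelder's inequality give the general case (\<open>hardy_sobolev_C1\<close>).
\<close>

section \<open>Integrals of powers by dyadic decomposition\<close>

lemma term_le_suminf_ennreal: "f i \<le> (\<Sum>j. f j :: ennreal)"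
  using sum_le_suminf[of f "{i}"] by simp

text \<open>
  If the sublevel sets of \<open>h\<close> have measure \<open>O(\<sigma> powr a)\<close>, then the part of the integral of \<open>h powr k\<close>
  that comes from \<open>h\<close> of order \<open>s / 2 ^ j\<close> decays geometrically in \<open>j\<close>. This serves both for powers of
  the distance to a thin set and for the singularity of the Riesz kernel.
\<close>

lemma nn_integral_powr_small:
  fixes h :: "'b \<Rightarrow> real" and M :: "'b measure"
  assumes [measurable]: "h \<in> borel_measurable M"
    and "s > 0" "a + k > 0" "B \<ge> 0"
    and vol: "\<And>\<sigma>. 0 < \<sigma> \<Longrightarrow> \<sigma> \<le> s \<Longrightarrow>
       emeasure M {x\<in>space M. 0 < h x \<and> h x \<le> \<sigma>} \<le> ennreal (B * \<sigma> powr a)"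
  shows "(\<integral>\<^sup>+x. indicator {x\<in>space M. 0 < h x \<and> h x \<le> s} x * ennreal (h x powr k) \<partial>M)
     \<le> ennreal (2 powr \<bar>k\<bar> / (1 - 2 powr (-(a+k))) * B * s powr (a+k))"
proof -
  define \<sigma> where "\<sigma> j = s / 2 ^ j" for j :: nat
  have \<sigma>: "0 < \<sigma> j" "\<sigma> j \<le> s" for j
    using \<open>s > 0\<close> by (auto simp: \<sigma>_def field_simps)
  let ?L = "\<lambda>j. {x\<in>space M. 0 < h x \<and> h x \<le> \<sigma> j}"
  have \<sigma>p: "\<sigma> j powr b = s powr b * (2 powr (-b)) ^ j" for j b
  proof -
    have "((2::real) ^ j) powr b = (2 powr b) ^ j"
      by (simp add: powr_powr mult.commute flip: powr_realpow)
    then show ?thesis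
      using \<open>s > 0\<close> by (simp add: \<sigma>_def powr_divide powr_minus power_inverse divide_simps)
  qed
  have pt: "indicator {x\<in>space M. 0 < h x \<and> h x \<le> s} x * ennreal (h x powr k)
     \<le> (\<Sum>j. ennreal (2 powr \<bar>k\<bar> * \<sigma> j powr k) * indicator (?L j) x)" if "x \<in> space M" for x
  proof (cases "0 < h x \<and> h x \<le> s")
    case True
    obtain j0 where "s / h x < 2 ^ j0"
      using real_arch_pow[of 2 "s / h x"] by auto
    then have ex: "\<sigma> j0 < h x"
      using True by (simp add: \<sigma>_def field_simps)
    define j where "j = (LEAST j. \<sigma> j < h x)"
    have j: "\<sigma> j < h x" unfolding j_def using ex by (rule LeastI)
    have "j \<noteq> 0"
    proof
      assume "j = 0"
      with j True show False by (simp add: \<sigma>_def)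
    qed
    then obtain i where i: "j = Suc i" by (cases j) auto
    then have "\<not> \<sigma> i < h x" unfolding j_def using not_less_Least
      by (metis j_def lessI)
    then have hi: "h x \<le> \<sigma> i" by simp
    have lo: "\<sigma> i / 2 \<le> h x" using j i by (simp add: \<sigma>_def)
    have "h x powr k \<le> 2 powr \<bar>k\<bar> * \<sigma> i powr k"
    proof (cases "k \<ge> 0")
      case True
      have "h x powr k \<le> \<sigma> i powr k"
        using hi \<open>0 < h x \<and> h x \<le> s\<close> True by (intro powr_mono2) auto
      also have "\<dots> \<le> 2 powr \<bar>k\<bar> * \<sigma> i powr k"
        using ge_one_powr_ge_zero[of 2 "\<bar>k\<bar>"] by (simp add: mult_le_cancel_right1 not_le powr_gt_zero)
      finally show ?thesis .
    next
      case False
      have "h x powr k \<le> (\<sigma> i / 2) powr k"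
        using lo \<sigma>(1)[of i] False by (intro powr_mono2') auto
      also have "\<dots> = 2 powr \<bar>k\<bar> * \<sigma> i powr k"
        using False \<sigma>(1)[of i] by (simp add: powr_divide powr_minus field_simps)
      finally show ?thesis .
    qed
    then have "indicator {x\<in>space M. 0 < h x \<and> h x \<le> s} x * ennreal (h x powr k)
       \<le> ennreal (2 powr \<bar>k\<bar> * \<sigma> i powr k) * indicator (?L i) x"
      using True hi that by (simp add: ennreal_leI)
    also have "\<dots> \<le> (\<Sum>j. ennreal (2 powr \<bar>k\<bar> * \<sigma> j powr k) * indicator (?L j) x)"
      by (rule term_le_suminf_ennreal)
    finally show ?thesis .
  qed auto
  define \<theta> where "\<theta> = (2::real) powr (-(a+k))"
  have \<theta>: "0 < \<theta>" "\<theta> < 1"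
    using \<open>a + k > 0\<close> powr_less_mono[of "-(a+k)" 0 "2::real"] by (auto simp: \<theta>_def)
  have "(\<integral>\<^sup>+x. indicator {x\<in>space M. 0 < h x \<and> h x \<le> s} x * ennreal (h x powr k) \<partial>M)
     \<le> (\<integral>\<^sup>+x. (\<Sum>j. ennreal (2 powr \<bar>k\<bar> * \<sigma> j powr k) * indicator (?L j) x) \<partial>M)"
    using pt by (intro nn_integral_mono)
  also have "\<dots> = (\<Sum>j. ennreal (2 powr \<bar>k\<bar> * \<sigma> j powr k) * emeasure M (?L j))"
    by (subst nn_integral_suminf) (auto simp: nn_integral_cmult_indicator)
  also have "\<dots> \<le> (\<Sum>j. ennreal (2 powr \<bar>k\<bar> * B * s powr (a+k) * \<theta> ^ j))"
  proof (intro suminf_le allI)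
    fix j
    have "ennreal (2 powr \<bar>k\<bar> * \<sigma> j powr k) * emeasure M (?L j)
      \<le> ennreal (2 powr \<bar>k\<bar> * \<sigma> j powr k) * ennreal (B * \<sigma> j powr a)"
      using vol \<sigma> by (intro mult_left_mono) auto
    also have "\<dots> = ennreal (2 powr \<bar>k\<bar> * B * \<sigma> j powr (a+k))"
      using \<open>B \<ge> 0\<close> by (simp add: powr_add ac_simps flip: ennreal_mult)
    also have "\<dots> = ennreal (2 powr \<bar>k\<bar> * B * s powr (a+k) * \<theta> ^ j)"
      unfolding \<sigma>p by (simp add: \<theta>_def ac_simps)
    finally show "ennreal (2 powr \<bar>k\<bar> * \<sigma> j powr k) * emeasure M (?L j)
      \<le> ennreal (2 powr \<bar>k\<bar> * B * s powr (a+k) * \<theta> ^ j)" .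
  qed auto
  also have "\<dots> = ennreal (2 powr \<bar>k\<bar> * B * s powr (a+k) * (1 / (1 - \<theta>)))"
    using \<theta> \<open>B \<ge> 0\<close> geometric_sums[of \<theta>]
    by (intro suminf_ennreal_eq sums_mult) auto
  finally show ?thesis by (simp add: \<theta>_def ac_simps)
qed

text \<open>
  The counterpart at infinity: the shells on which \<open>h\<close> is of order \<open>2 ^ j * s\<close> contribute a geometric series.
\<close>

lemma nn_integral_powr_large:
  fixes h :: "'b \<Rightarrow> real" and M :: "'b measure"
  assumes [measurable]: "h \<in> borel_measurable M"
    and "s > 0" "a + k < 0" "k \<le> 0" "B \<ge> 0"
    and vol: "\<And>\<sigma>. s \<le> \<sigma> \<Longrightarrow>
       emeasure M {x\<in>space M. h x \<le> \<sigma>} \<le> ennreal (B * \<sigma> powr a)"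
  shows "(\<integral>\<^sup>+x. indicator {x\<in>space M. s < h x} x * ennreal (h x powr k) \<partial>M)
     \<le> ennreal (2 powr a / (1 - 2 powr (a+k)) * B * s powr (a+k))"
proof -
  define \<sigma> where "\<sigma> j = s * 2 ^ j" for j :: nat
  have \<sigma>: "0 < \<sigma> j" "s \<le> \<sigma> j" for j
    using \<open>s > 0\<close> by (auto simp: \<sigma>_def)
  let ?L = "\<lambda>j. {x\<in>space M. h x \<le> 2 * \<sigma> j}"
  have \<sigma>p: "\<sigma> j powr b = s powr b * (2 powr b) ^ j" for j b
    using \<open>s > 0\<close> by (simp add: \<sigma>_def powr_mult flip: powr_realpow) (simp add: powr_powr mult.commute)
  have pt: "indicator {x\<in>space M. s < h x} x * ennreal (h x powr k)
     \<le> (\<Sum>j. ennreal (\<sigma> j powr k) * indicator (?L j) x)" if "x \<in> space M" for x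
  proof (cases "s < h x")
    case True
    obtain j0 where "h x / s < 2 ^ j0"
      using real_arch_pow[of 2 "h x / s"] by auto
    then have ex: "h x \<le> \<sigma> j0"
      using True \<open>s > 0\<close> by (simp add: \<sigma>_def field_simps)
    define j where "j = (LEAST j. h x \<le> \<sigma> j)"
    have j: "h x \<le> \<sigma> j" unfolding j_def using ex by (rule LeastI)
    have "j \<noteq> 0"
    proof
      assume "j = 0"
      with j True show False by (simp add: \<sigma>_def)
    qed
    then obtain i where i: "j = Suc i" by (cases j) auto
    then have lo: "\<sigma> i \<le> h x" unfolding j_def using not_less_Least
      by (metis j_def lessI linorder_le_less_linear order_less_imp_le)
    have hi: "h x \<le> 2 * \<sigma> i" using j i by (simp add: \<sigma>_def)
    have "h x powr k \<le> \<sigma> i powr k"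
      using lo \<sigma>(1)[of i] \<open>k \<le> 0\<close> by (intro powr_mono2') auto
    then have "indicator {x\<in>space M. s < h x} x * ennreal (h x powr k)
       \<le> ennreal (\<sigma> i powr k) * indicator (?L i) x"
      using True hi that by (simp add: ennreal_leI)
    also have "\<dots> \<le> (\<Sum>j. ennreal (\<sigma> j powr k) * indicator (?L j) x)"
      by (rule term_le_suminf_ennreal)
    finally show ?thesis .
  qed auto
  define \<theta> where "\<theta> = (2::real) powr (a+k)"
  have \<theta>: "0 < \<theta>" "\<theta> < 1"
    using \<open>a + k < 0\<close> powr_less_mono[of "a+k" 0 "2::real"] by (auto simp: \<theta>_def)
  have "(\<integral>\<^sup>+x. indicator {x\<in>space M. s < h x} x * ennreal (h x powr k) \<partial>M)
     \<le> (\<integral>\<^sup>+x. (\<Sum>j. ennreal (\<sigma> j powr k) * indicator (?L j) x) \<partial>M)"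
    using pt by (intro nn_integral_mono)
  also have "\<dots> = (\<Sum>j. ennreal (\<sigma> j powr k) * emeasure M (?L j))"
    by (subst nn_integral_suminf) (auto simp: nn_integral_cmult_indicator)
  also have "\<dots> \<le> (\<Sum>j. ennreal (2 powr a * B * s powr (a+k) * \<theta> ^ j))"
  proof (intro suminf_le allI)
    fix j
    have "ennreal (\<sigma> j powr k) * emeasure M (?L j)
      \<le> ennreal (\<sigma> j powr k) * ennreal (B * (2 * \<sigma> j) powr a)"
      using vol[of "2 * \<sigma> j"] \<sigma>[of j] by (intro mult_left_mono) auto
    also have "\<dots> = ennreal (2 powr a * B * \<sigma> j powr (a+k))"
      using \<open>B \<ge> 0\<close> by (simp add: powr_add powr_mult ac_simps flip: ennreal_mult)
    also have "\<dots> = ennreal (2 powr a * B * s powr (a+k) * \<theta> ^ j)"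
      unfolding \<sigma>p by (simp add: \<theta>_def ac_simps)
    finally show "ennreal (\<sigma> j powr k) * emeasure M (?L j)
      \<le> ennreal (2 powr a * B * s powr (a+k) * \<theta> ^ j)" .
  qed auto
  also have "\<dots> = ennreal (2 powr a * B * s powr (a+k) * (1 / (1 - \<theta>)))"
    using \<theta> \<open>B \<ge> 0\<close> geometric_sums[of \<theta>]
    by (intro suminf_ennreal_eq sums_mult) auto
  finally show ?thesis by (simp add: \<theta>_def ac_simps)
qed

section \<open>Coverings from the Assouad dimension\<close>

lemma covering_number_le:
  assumes "F \<subseteq> A" "finite F" "A \<subseteq> (\<Union>y\<in>F. ball y r)"
  shows "covering_number A r \<le> card F"
  unfolding covering_number_def by (rule Least_le) (use assms in blast)

lemma covering_number_attained:
  assumes "F \<subseteq> A" "finite F" "A \<subseteq> (\<Union>y\<in>F. ball y r)"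
  obtains F' where "F' \<subseteq> A" "finite F'" "card F' = covering_number A r" "A \<subseteq> (\<Union>y\<in>F'. ball y r)"
proof -
  have "\<exists>F'\<subseteq>A. finite F' \<and> card F' = covering_number A r \<and> A \<subseteq> (\<Union>y\<in>F'. ball y r)"
    unfolding covering_number_def by (rule LeastI[of _ "card F"]) (use assms in blast)
  then show ?thesis using that by blast
qed

text \<open>
  The balls of radius \<open>r / 2\<close> around the points of \<open>F\<close> are disjoint and lie in a ball of radius \<open>3 * R / 2\<close>.
\<close>

lemma card_separated_le:
  fixes F :: "'a::euclidean_space set"
  assumes "finite F" "F \<subseteq> ball x R" "0 < r" "r \<le> R"
    and sep: "\<And>y z. y \<in> F \<Longrightarrow> z \<in> F \<Longrightarrow> y \<noteq> z \<Longrightarrow> r \<le> dist y z"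
  shows "real (card F) \<le> (3 * R / r) ^ DIM('a)"
proof -
  let ?\<omega> = "unit_ball_vol (real DIM('a))"
  have disj: "disjoint_family_on (\<lambda>y. ball y (r/2)) F"
    unfolding disjoint_family_on_def
  proof (intro ballI impI)
    fix y z assume "y \<in> F" "z \<in> F" "y \<noteq> z"
    then have "r / 2 + r / 2 \<le> dist y z" using sep by simp
    then show "ball y (r/2) \<inter> ball z (r/2) = {}" by (rule disjoint_ballI)
  qed
  have "ennreal (real (card F) * (?\<omega> * (r/2) ^ DIM('a))) = (\<Sum>y\<in>F. emeasure lborel (ball y (r/2)))"
    using \<open>0 < r\<close> by (simp add: emeasure_ball ennreal_mult ennreal_of_nat_eq_real_of_nat)
  also have "\<dots> = emeasure lborel (\<Union>y\<in>F. ball y (r/2))"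
    by (rule sum_emeasure) (use disj \<open>finite F\<close> in auto)
  also have "\<dots> \<le> emeasure lborel (ball x (3 * R / 2))"
  proof (intro emeasure_mono UN_least)
    fix y assume "y \<in> F"
    then have "dist x y < R" using assms by auto
    then show "ball y (r/2) \<subseteq> ball x (3 * R / 2)"
      using \<open>r \<le> R\<close> by (simp add: ball_subset_ball_iff dist_commute)
  qed auto
  also have "\<dots> = ennreal (?\<omega> * (3 * R / 2) ^ DIM('a))"
    using assms by (simp add: emeasure_ball)
  finally have "real (card F) * (?\<omega> * (r/2) ^ DIM('a)) \<le> ?\<omega> * (3 * R / 2) ^ DIM('a)"
    using assms by (simp add: ennreal_le_iff)
  then have "real (card F) * (r/2) ^ DIM('a) \<le> (3 * R / 2) ^ DIM('a)"
    using unit_ball_vol_pos[of "real DIM('a)"] by (simp add: mult.left_commute)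
  then have "real (card F) \<le> (3 * R / 2) ^ DIM('a) / (r/2) ^ DIM('a)"
    using \<open>0 < r\<close> by (simp add: field_simps)
  also have "\<dots> = (3 * R / r) ^ DIM('a)"
    using \<open>0 < r\<close> by (simp add: power_divide[symmetric])
  finally show ?thesis .
qed

text \<open>
  A separated subset of maximal cardinality is a net. Besides showing that covering numbers are
  attained, this puts the dimension of the space among the admissible exponents, so that the infimum
  in the Assouad dimension is over a non-empty set.
\<close>

lemma separated_net:
  fixes A :: "'a::euclidean_space set"
  assumes "A \<subseteq> ball x R" "0 < r" "r \<le> R"
  obtains F where "F \<subseteq> A" "finite F" "A \<subseteq> (\<Union>y\<in>F. ball y r)" "real (card F) \<le> (3 * R / r) ^ DIM('a)"
proof -
  define sep where "sep F \<longleftrightarrow> finite F \<and> F \<subseteq> A \<and> (\<forall>y\<in>F. \<forall>z\<in>F. y \<noteq> z \<longrightarrow> r \<le> dist y z)" for F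
  have bd: "real (card F) \<le> (3 * R / r) ^ DIM('a)" if "sep F" for F
    by (rule card_separated_le[of _ x]) (use that assms in \<open>auto simp: sep_def\<close>)
  have "\<exists>F. sep F \<and> (\<forall>F'. sep F' \<longrightarrow> card F' \<le> card F)"
  proof (rule ex_has_greatest_nat)
    show "sep {}" by (simp add: sep_def)
    show "\<forall>F. sep F \<longrightarrow> card F < Suc (nat \<lfloor>(3 * R / r) ^ DIM('a)\<rfloor>)"
      using bd by (auto simp: less_Suc_eq_le le_nat_floor)
  qed
  then obtain F where F: "sep F" and max: "\<And>F'. sep F' \<Longrightarrow> card F' \<le> card F" by blast
  have "A \<subseteq> (\<Union>y\<in>F. ball y r)"
  proof (rule ccontr)
    assume "\<not> ?thesis"
    then obtain z where "z \<in> A" "z \<notin> (\<Union>y\<in>F. ball y r)" by blast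
    then have z: "z \<in> A" "\<And>y. y \<in> F \<Longrightarrow> r \<le> dist y z" by (auto simp: not_less)
    then have "z \<notin> F" using \<open>0 < r\<close> by force
    have "sep (insert z F)" using F z by (auto simp: sep_def dist_commute)
    from max[OF this] \<open>z \<notin> F\<close> F show False by (auto simp: sep_def)
  qed
  then show ?thesis using that F bd by (auto simp: sep_def)
qed

text \<open>
  Unlike in the definition of the Assouad dimension, the radius \<open>R\<close> is unbounded here and the centres
  may lie anywhere in \<open>E\<close>; this removes the special role of the diameter.
\<close>

definition assouad_cover :: "'a::metric_space set \<Rightarrow> real \<Rightarrow> real \<Rightarrow> bool" where
  "assouad_cover E d K \<longleftrightarrow> (\<forall>z\<in>E. \<forall>r R. 0 < r \<and> r \<le> R \<longrightarrow>
     (\<exists>F\<subseteq>E. finite F \<and> real (card F) \<le> K * (R / r) powr d \<and> E \<inter> ball z R \<subseteq> (\<Union>y\<in>F. ball y r)))"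

text \<open>
  Radii beyond the diameter are reduced to radii below it: a bounded set is covered by finitely many
  balls whose radius is half of its diameter.
\<close>

lemma upper_assouad_dim_less_imp_cover:
  fixes E :: "'a::euclidean_space set"
  assumes "upper_assouad_dim E < b"
  obtains d K where "0 \<le> d" "d < b" "0 < K" "assouad_cover E d K"
proof -
  define L where "L = {l. 0 \<le> l \<and>
     (\<exists>C>0. \<forall>x\<in>E. \<forall>r R. 0 < r \<and> r < R \<and> ereal R < ext_diameter E \<longrightarrow>
        real (covering_number (E \<inter> ball x R) r) \<le> C * (r / R) powr (- l))}"
  have "real DIM('a) \<in> L"
    unfolding L_def
  proof (intro CollectI conjI exI[of _ "3 ^ DIM('a)"] ballI allI impI)
    fix x r R assume "x \<in> E" and rR: "0 < r \<and> r < R \<and> ereal R < ext_diameter E"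
    obtain F where F: "F \<subseteq> E \<inter> ball x R" "finite F" "E \<inter> ball x R \<subseteq> (\<Union>y\<in>F. ball y r)"
       "real (card F) \<le> (3 * R / r) ^ DIM('a)"
      by (rule separated_net[of "E \<inter> ball x R" x R r]) (use rR in auto)
    have "real (covering_number (E \<inter> ball x R) r) \<le> (3 * R / r) ^ DIM('a)"
      using covering_number_le[OF F(1-3)] F(4) by linarith
    also have "\<dots> = 3 ^ DIM('a) * (r / R) powr (- real DIM('a))"
      using rR by (simp add: powr_minus powr_realpow field_simps)
    finally show "real (covering_number (E \<inter> ball x R) r) \<le> 3 ^ DIM('a) * (r / R) powr (- real DIM('a))" .
  qed auto
  then have "L \<noteq> {}" by auto
  moreover have "Inf L < b" using assms by (simp add: upper_assouad_dim_def L_def)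
  ultimately obtain d where "d \<in> L" "d < b" using cInf_lessD by blast
  then obtain C where d: "0 \<le> d" "C > 0" and
    C: "\<And>x r R. x \<in> E \<Longrightarrow> 0 < r \<Longrightarrow> r < R \<Longrightarrow> ereal R < ext_diameter E \<Longrightarrow>
        real (covering_number (E \<inter> ball x R) r) \<le> C * (r / R) powr (- d)"
    by (auto simp: L_def)
  have cov: "\<exists>F\<subseteq>E. finite F \<and> real (card F) \<le> C * (R / r) powr d \<and> E \<inter> ball z R \<subseteq> (\<Union>y\<in>F. ball y r)"
    if "z \<in> E" "0 < r" "r < R" "ereal R < ext_diameter E" for z r R
  proof -
    note zr = that
    obtain F where F: "F \<subseteq> E \<inter> ball z R" "finite F" "E \<inter> ball z R \<subseteq> (\<Union>y\<in>F. ball y r)"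
      by (rule separated_net[of "E \<inter> ball z R" z R r]) (use zr in auto)
    obtain F' where F': "F' \<subseteq> E \<inter> ball z R" "finite F'" "E \<inter> ball z R \<subseteq> (\<Union>y\<in>F'. ball y r)"
      and card: "card F' = covering_number (E \<inter> ball z R) r"
      by (rule covering_number_attained[OF F])
    have "(r / R) powr (- d) = (R / r) powr d"
      using zr by (simp add: powr_minus powr_divide)
    then have "real (card F') \<le> C * (R / r) powr d" using C[of z r R] zr card by simp
    with F' show ?thesis by blast
  qed
  have one: "1 \<le> (R / r) powr d" if "0 < r" "r \<le> R" for r R
    using that d by (intro ge_one_powr_ge_zero) auto
  show ?thesis
  proof (cases "bounded E \<and> diameter E > 0")
    case True
    then have D: "0 < diameter E" and b: "bounded E" by auto
    obtain x0 R0 where "E \<subseteq> ball x0 R0" using b bounded_subset_ballD by blast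
    then have "E \<subseteq> ball x0 (max R0 (diameter E / 2))" by auto
    then obtain N where N: "N \<subseteq> E" "finite N" "E \<subseteq> (\<Union>y\<in>N. ball y (diameter E / 2))"
      by (rule separated_net[where r = "diameter E / 2"]) (use D in auto)
    define K where "K = (real (card N) + 1) * (C + 1)"
    have K: "K > 0" using d by (simp add: K_def add_nonneg_pos)
    have NK: "real (card N) \<le> K" "real (card N) * C \<le> K" "C \<le> K" "1 \<le> K"
      using d by (auto simp: K_def algebra_simps)
    have "assouad_cover E d K"
      unfolding assouad_cover_def
    proof (intro ballI allI impI, elim conjE)
      fix z r R assume z: "z \<in> E" and r: "0 < (r::real)" "r \<le> R"
      have KR: "c \<le> K * (R / r) powr d" if "c \<le> K" for c
        using one[OF r] K that mult_left_mono[of 1 "(R / r) powr d" K] by linarith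
      \<comment> \<open>Use the covering of all of \<open>E\<close>, a single ball, the hypothesis, or the hypothesis in each ball of
        the covering of \<open>E\<close>, in this order.\<close>
      from r consider "diameter E / 2 \<le> r" | "r < diameter E / 2" "r = R" 
        | "r < R" "R < diameter E" | "r < diameter E / 2" "diameter E \<le> R"
        by argo
      then show "\<exists>F\<subseteq>E. finite F \<and> real (card F) \<le> K * (R / r) powr d \<and> E \<inter> ball z R \<subseteq> (\<Union>y\<in>F. ball y r)"
      proof cases
        case 1
        have "ball y (diameter E / 2) \<subseteq> ball y r" for y using 1 by (rule subset_ball)
        then have "E \<inter> ball z R \<subseteq> (\<Union>y\<in>N. ball y r)" using N(3) by blast
        moreover have "real (card N) \<le> K * (R / r) powr d"
          using NK(1) by (rule KR)
        ultimately show ?thesis using N by blast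
      next
        case 2
        have "E \<inter> ball z R \<subseteq> (\<Union>y\<in>{z}. ball y r)" using 2 by auto
        moreover have "real (card {z}) \<le> K * (R / r) powr d"
          using KR[OF NK(4)] by simp
        ultimately show ?thesis using z by blast
      next
        case 3
        then obtain F where F: "F\<subseteq>E" "finite F" "real (card F) \<le> C * (R / r) powr d" "E \<inter> ball z R \<subseteq> (\<Union>y\<in>F. ball y r)"
          using cov[of z r R] z r b by (auto simp: ext_diameter_def)
        moreover have "C * (R / r) powr d \<le> K * (R / r) powr d"
          using NK by (intro mult_right_mono) auto
        ultimately show ?thesis by (intro exI[of _ F]) auto
      next
        case 4
        have "\<exists>F\<subseteq>E. finite F \<and> real (card F) \<le> C * (diameter E / 2 / r) powr d \<and> E \<inter> ball y (diameter E / 2) \<subseteq> (\<Union>y\<in>F. ball y r)"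
          if "y \<in> N" for y
          using cov[of y r "diameter E / 2"] that N 4 r b D by (auto simp: ext_diameter_def)
        then obtain F where F: "\<And>y. y \<in> N \<Longrightarrow> F y \<subseteq> E" "\<And>y. y \<in> N \<Longrightarrow> finite (F y)"
           "\<And>y. y \<in> N \<Longrightarrow> real (card (F y)) \<le> C * (diameter E / 2 / r) powr d"
           "\<And>y. y \<in> N \<Longrightarrow> E \<inter> ball y (diameter E / 2) \<subseteq> (\<Union>y\<in>F y. ball y r)"
          by metis
        have "real (card (\<Union>y\<in>N. F y)) \<le> (\<Sum>y\<in>N. real (card (F y)))"
          using card_UN_le[OF N(2), of F] by (metis of_nat_le_iff of_nat_sum)
        also have "\<dots> \<le> (\<Sum>y\<in>N. C * (diameter E / 2 / r) powr d)" by (intro sum_mono F)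
        also have "\<dots> = (real (card N) * C) * (diameter E / 2 / r) powr d" by simp
        also have "\<dots> \<le> K * (R / r) powr d"
          using NK d r 4 D by (intro mult_mono powr_mono2) (auto simp: divide_simps)
        finally have "real (card (\<Union>y\<in>N. F y)) \<le> K * (R / r) powr d" .
        moreover have "E \<inter> ball z R \<subseteq> (\<Union>y\<in>(\<Union>y\<in>N. F y). ball y r)"
        proof
          fix e assume "e \<in> E \<inter> ball z R"
          then obtain y where "y \<in> N" "e \<in> E \<inter> ball y (diameter E / 2)" using N(3) by blast
          then show "e \<in> (\<Union>y\<in>(\<Union>y\<in>N. F y). ball y r)" using F(4) by blast
        qed
        ultimately show ?thesis
          using F(1,2) N(2) by (intro exI[of _ "\<Union>y\<in>N. F y"]) auto
      qed
    qed
    with d K \<open>d < b\<close> show ?thesis using that by blast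
  next
    case False
    have "assouad_cover E d (C + 1)"
      unfolding assouad_cover_def
    proof (intro ballI allI impI, elim conjE)
      fix z r R assume z: "z \<in> E" and r: "0 < (r::real)" "r \<le> R"
      have K1: "1 \<le> (C + 1) * (R / r) powr d"
        using one[OF r] d mult_mono[of 1 "C+1" 1 "(R/r) powr d"] by linarith
      show "\<exists>F\<subseteq>E. finite F \<and> real (card F) \<le> (C + 1) * (R / r) powr d \<and> E \<inter> ball z R \<subseteq> (\<Union>y\<in>F. ball y r)"
      proof (cases "r = R \<or> bounded E")
        case True
        have "E \<inter> ball z R \<subseteq> (\<Union>y\<in>{z}. ball y r)"
        proof (cases "r = R")
          case False
          with True have "bounded E" by simp
          have "e = z" if "e \<in> E" for e
            using diameter_bounded_bound[OF \<open>bounded E\<close> that z] \<open>bounded E\<close> \<open>\<not> (bounded E \<and> diameter E > 0)\<close>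
            by (metis dist_le_zero_iff not_less order_trans)
          then show ?thesis using r by auto
        qed auto
        then show ?thesis using z K1 by (intro exI[of _ "{z}"]) auto
      next
        case False
        then obtain F where F: "F\<subseteq>E" "finite F" "real (card F) \<le> C * (R / r) powr d" "E \<inter> ball z R \<subseteq> (\<Union>y\<in>F. ball y r)"
          using cov[of z r R] z r by (auto simp: ext_diameter_def)
        moreover have "C * (R / r) powr d \<le> (C + 1) * (R / r) powr d"
          by (intro mult_right_mono) auto
        ultimately show ?thesis by (intro exI[of _ F]) auto
      qed
    qed
    moreover have "C + 1 > 0" using d by simp
    ultimately show ?thesis using that d \<open>d < b\<close> by blast
  qed
qed

section \<open>The volume near a thin set\<close>

text \<open>
  The dimension of the space is carried as a real parameter \<open>n\<close>, because it mostly occurs in exponents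
  of \<open>powr\<close>.
\<close>

locale thin_set =
  fixes E :: "'a::euclidean_space set" and d K n :: real
  assumes n_eq: "n = real DIM('a)"
    and closed_E: "closed E" and E_nonempty: "E \<noteq> {}"
    and d_nonneg: "0 \<le> d" and d_less: "d < n - 1" and K_pos: "0 < K"
    and cover: "assouad_cover E d K"
begin

abbreviation \<delta> :: "'a \<Rightarrow> real" where "\<delta> x \<equiv> infdist x E"
abbreviation \<omega> :: real where "\<omega> \<equiv> unit_ball_vol n"

lemma n_gt_1: "n > 1" and d_less_n: "d < n"
  using d_nonneg d_less by auto

lemma ball_vol_pos [simp]: "\<omega> > 0" "\<omega> \<ge> 0"
  using n_gt_1 by auto

lemma emeasure_ball_powr: "r > 0 \<Longrightarrow> emeasure lborel (ball (x::'a) r) = ennreal (\<omega> * r powr n)"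
  and emeasure_cball_powr: "r > 0 \<Longrightarrow> emeasure lborel (cball (x::'a) r) = ennreal (\<omega> * r powr n)"
  by (simp_all add: emeasure_ball emeasure_cball powr_realpow n_eq)

lemma nearest_point:
  obtains z where "z \<in> E" "\<delta> x = dist x z"
  using infdist_attains_inf[OF closed_E E_nonempty] by blast

lemma dist_pos_iff: "\<delta> x > 0 \<longleftrightarrow> x \<notin> E"
  using closed_E E_nonempty in_closed_iff_infdist_zero[of E x] infdist_nonneg[of x E] by auto

lemma dist_triangle_le: "\<delta> x \<le> \<delta> y + dist x y"
  by (rule infdist_triangle)

lemma dist_measurable [measurable]: "(\<lambda>x. \<delta> x) \<in> borel_measurable borel"
  by (intro borel_measurable_continuous_onI continuous_intros)

lemma measure_neighbourhood_le:
  assumes "z \<in> E" "0 < s" "s \<le> R"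
  shows "emeasure lborel {x\<in>ball z R. \<delta> x \<le> s} \<le> ennreal (K * 2 powr d * 2 powr n * \<omega> * R powr d * s powr (n - d))"
proof -
  obtain F where F: "finite F" "real (card F) \<le> K * (2 * R / s) powr d" "E \<inter> ball z (2 * R) \<subseteq> (\<Union>y\<in>F. ball y s)"
    using cover[unfolded assouad_cover_def, rule_format, OF \<open>z \<in> E\<close>, of s "2 * R"] assms by auto
  have "{x\<in>ball z R. \<delta> x \<le> s} \<subseteq> (\<Union>y\<in>F. cball y (2 * s))"
  proof
    fix x assume x: "x \<in> {x\<in>ball z R. \<delta> x \<le> s}"
    obtain e where e: "e \<in> E" "\<delta> x = dist x e" by (rule nearest_point)
    have "dist z e < 2 * R" using x e assms dist_triangle[of z e x] by auto
    then obtain y where y: "y \<in> F" "e \<in> ball y s" using F e by auto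
    then have "dist y x \<le> 2 * s" using x e dist_triangle[of y x e] by (auto simp: dist_commute)
    then show "x \<in> (\<Union>y\<in>F. cball y (2 * s))" using y by auto
  qed
  then have "emeasure lborel {x\<in>ball z R. \<delta> x \<le> s} \<le> emeasure lborel (\<Union>y\<in>F. cball y (2 * s))"
    using F(1) by (intro emeasure_mono) (auto intro!: borel_closed closed_UN)
  also have "\<dots> \<le> (\<Sum>y\<in>F. emeasure lborel (cball y (2 * s)))"
    using F by (intro emeasure_subadditive_finite) auto
  also have "\<dots> = ennreal (real (card F) * (\<omega> * (2 * s) powr n))"
    using \<open>0 < s\<close> by (simp add: emeasure_cball_powr ennreal_mult ennreal_of_nat_eq_real_of_nat)
  also have "\<dots> \<le> ennreal (K * (2 * R / s) powr d * (\<omega> * (2 * s) powr n))"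
    by (intro ennreal_leI mult_right_mono F) auto
  also have "K * (2 * R / s) powr d * (\<omega> * (2 * s) powr n) = K * 2 powr d * 2 powr n * \<omega> * R powr d * s powr (n - d)"
    using assms by (simp add: powr_divide powr_mult powr_diff)
  finally show ?thesis .
qed

text \<open>
  The constant that \<open>nn_integral_powr_small\<close> produces from \<open>measure_neighbourhood_le\<close>.
\<close>

definition layer_const :: "real \<Rightarrow> real" where
  "layer_const a = 2 powr \<bar>a - n\<bar> / (1 - 2 powr (-(a - d))) * (K * 2 powr d * 2 powr n * \<omega>)"

lemma layer_const_nonneg: "a > d \<Longrightarrow> layer_const a \<ge> 0"
  unfolding layer_const_def using K_pos powr_mono[of "-(a-d)" 0 "2::real"]
  by (intro mult_nonneg_nonneg divide_nonneg_nonneg) auto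

text \<open>
  The exponent \<open>a - n\<close> may be as negative as \<open>d - n\<close>, excluding the endpoint, since the neighbourhood
  of width \<open>\<sigma>\<close> has volume of order \<open>\<sigma> powr (n - d)\<close>.
\<close>

lemma weighted_measure_neighbourhood_le:
  assumes "z \<in> E" "0 < s" "s \<le> R" "a > d"
  shows "(\<integral>\<^sup>+x. indicator {x\<in>ball z R. 0 < \<delta> x \<and> \<delta> x \<le> s} x * ennreal (\<delta> x powr (a - n)) \<partial>lborel)
    \<le> ennreal (layer_const a * R powr d * s powr (a - d))"
proof -
  let ?M = "restrict_space lborel (ball z R)"
  have sp: "space ?M = ball z R" by (simp add: space_restrict_space)
  have "(\<integral>\<^sup>+x. indicator {x\<in>space ?M. 0 < \<delta> x \<and> \<delta> x \<le> s} x * ennreal (\<delta> x powr (a - n)) \<partial>?M)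
     \<le> ennreal (2 powr \<bar>a - n\<bar> / (1 - 2 powr (-((n - d)+(a - n)))) * (K * 2 powr d * 2 powr n * \<omega> * R powr d) * s powr ((n - d)+(a - n)))"
  proof (rule nn_integral_powr_small)
    fix \<sigma> :: real assume \<sigma>: "0 < \<sigma>" "\<sigma> \<le> s"
    have "emeasure ?M {x \<in> space ?M. 0 < \<delta> x \<and> \<delta> x \<le> \<sigma>} = emeasure lborel {x\<in>ball z R. 0 < \<delta> x \<and> \<delta> x \<le> \<sigma>}"
      by (subst emeasure_restrict_space) (auto simp: sp)
    also have "\<dots> \<le> emeasure lborel {x\<in>ball z R. \<delta> x \<le> \<sigma>}"
      by (intro emeasure_mono) auto
    also have "\<dots> \<le> ennreal (K * 2 powr d * 2 powr n * \<omega> * R powr d * \<sigma> powr (n - d))"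
      using \<sigma> assms by (intro measure_neighbourhood_le) auto
    finally show "emeasure ?M {x \<in> space ?M. 0 < \<delta> x \<and> \<delta> x \<le> \<sigma>} \<le> \<dots>" .
  next
    show "\<delta> \<in> borel_measurable ?M" by (intro measurable_restrict_space1) measurable
  qed (use assms K_pos in auto)
  also have "(\<integral>\<^sup>+x. indicator {x\<in>space ?M. 0 < \<delta> x \<and> \<delta> x \<le> s} x * ennreal (\<delta> x powr (a - n)) \<partial>?M)
    = (\<integral>\<^sup>+x. indicator {x\<in>ball z R. 0 < \<delta> x \<and> \<delta> x \<le> s} x * ennreal (\<delta> x powr (a - n)) \<partial>lborel)"
    by (subst nn_integral_restrict_space) (auto simp: sp indicator_def intro!: nn_integral_cong)
  also have "2 powr \<bar>a - n\<bar> / (1 - 2 powr (-((n - d)+(a - n)))) * (K * 2 powr d * 2 powr n * \<omega> * R powr d) * s powr ((n - d)+(a - n))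
    = layer_const a * R powr d * s powr (a - d)"
    by (simp add: layer_const_def algebra_simps)
  finally show ?thesis .
qed

text \<open>
  With \<open>h = \<delta> y\<close> this is the weighted measure on the set of those points \<open>x\<close> whose values can be
  influenced by the gradient at \<open>y\<close> in \<open>pointwise_bound\<close>.
\<close>

definition below_measure :: "real \<Rightarrow> real \<Rightarrow> real \<Rightarrow> 'a measure" where
  "below_measure a c h = density lborel (\<lambda>x. indicator {x. 0 < \<delta> x \<and> c * \<delta> x \<le> h} x * ennreal (\<delta> x powr (a - n)))"

lemma space_below_measure [simp]: "space (below_measure a c h) = UNIV"
  and sets_below_measure [simp, measurable_cong]: "sets (below_measure a c h) = sets borel"
  by (auto simp: below_measure_def)

lemma emeasure_below_measure:
  "A \<in> sets borel \<Longrightarrow> emeasure (below_measure a c h) A =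
     (\<integral>\<^sup>+x. indicator {x\<in>A. 0 < \<delta> x \<and> c * \<delta> x \<le> h} x * ennreal (\<delta> x powr (a - n)) \<partial>lborel)"
  unfolding below_measure_def
  by (subst emeasure_density) (auto simp: indicator_def intro!: nn_integral_cong)

text \<open>
  At radii above \<open>\<delta> y\<close> the measure lives on the part of a neighbourhood of \<open>E\<close> of width \<open>\<delta> y / c\<close>
  in a ball of radius comparable with \<open>\<rho>\<close> around a point of \<open>E\<close>, and so it grows with the exponent \<open>d\<close>.
\<close>

lemma below_measure_cball_large:
  assumes "a > d" "0 < c" "c \<le> 1"
  obtains C where "C > 0"
    "\<And>y \<rho>. 0 < \<delta> y \<Longrightarrow> \<delta> y \<le> \<rho> \<Longrightarrow>
       emeasure (below_measure a c (\<delta> y)) (cball y \<rho>) \<le> ennreal (C * \<delta> y powr (a - d) * \<rho> powr d)"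
proof
  let ?C = "layer_const a * (3 / c) powr d * (1 / c) powr (a - d)"
  show "?C + 1 > 0" using layer_const_nonneg[OF \<open>a > d\<close>] by (simp add: add_nonneg_pos)
  fix y \<rho> assume y: "0 < \<delta> y" "\<delta> y \<le> \<rho>"
  obtain z where z: "z \<in> E" "\<delta> y = dist y z" by (rule nearest_point)
  have "\<rho> > 0" using y by linarith
  have c3: "3 * \<rho> \<le> 3 * \<rho> / c" using assms y by (simp add: field_simps)
  have "emeasure (below_measure a c (\<delta> y)) (cball y \<rho>)
    \<le> (\<integral>\<^sup>+x. indicator {x\<in>ball z (3 * \<rho> / c). 0 < \<delta> x \<and> \<delta> x \<le> \<delta> y / c} x * ennreal (\<delta> x powr (a - n)) \<partial>lborel)"
  proof (subst emeasure_below_measure, simp, intro nn_integral_mono mult_right_mono)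
    fix x
    have "x \<in> ball z (3 * \<rho> / c)" if "x \<in> cball y \<rho>"
    proof -
      have "dist z x \<le> dist y z + dist y x" by (metis dist_commute dist_triangle)
      then have "dist z x < 3 * \<rho> / c"
        using that z(2) y c3 \<open>\<rho> > 0\<close> unfolding mem_cball by linarith
      then show ?thesis by simp
    qed
    then show "indicator {x \<in> cball y \<rho>. 0 < \<delta> x \<and> c * \<delta> x \<le> \<delta> y} x
      \<le> (indicator {x\<in>ball z (3 * \<rho> / c). 0 < \<delta> x \<and> \<delta> x \<le> \<delta> y / c} x :: ennreal)"
      using \<open>0 < c\<close> by (auto simp: indicator_def field_simps)
  qed simp
  also have "\<dots> \<le> ennreal (layer_const a * (3 * \<rho> / c) powr d * (\<delta> y / c) powr (a - d))"
  proof (rule weighted_measure_neighbourhood_le)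
    show "\<delta> y / c \<le> 3 * \<rho> / c" using assms y by (intro divide_right_mono) auto
  qed (use assms y z in auto)
  also have "layer_const a * (3 * \<rho> / c) powr d * (\<delta> y / c) powr (a - d) = ?C * \<delta> y powr (a - d) * \<rho> powr d"
    using assms y by (simp add: powr_divide powr_mult)
  also have "ennreal \<dots> \<le> ennreal ((?C + 1) * \<delta> y powr (a - d) * \<rho> powr d)"
    by (intro ennreal_leI mult_right_mono) auto
  finally show "emeasure (below_measure a c (\<delta> y)) (cball y \<rho>) \<le> ennreal ((?C + 1) * \<delta> y powr (a - d) * \<rho> powr d)" .
qed

text \<open>
  Near \<open>y\<close> the weight is almost constant. Far away \<open>(\<rho> / \<delta> y) powr d\<close> is dominated by
  \<open>(\<rho> / \<delta> y) powr n\<close>.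
\<close>

lemma below_measure_cball_all:
  assumes "a > d" "0 < c" "c \<le> 1"
  obtains C where "C > 0"
    "\<And>y \<rho>. 0 < \<delta> y \<Longrightarrow> 0 < \<rho> \<Longrightarrow>
       emeasure (below_measure a c (\<delta> y)) (cball y \<rho>) \<le> ennreal (C * \<delta> y powr (a - n) * \<rho> powr n)"
proof -
  obtain C where C: "C > 0"
    "\<And>y \<rho>. 0 < \<delta> y \<Longrightarrow> \<delta> y \<le> \<rho> \<Longrightarrow>
       emeasure (below_measure a c (\<delta> y)) (cball y \<rho>) \<le> ennreal (C * \<delta> y powr (a - d) * \<rho> powr d)"
    using below_measure_cball_large[OF assms] by blast
  show ?thesis
  proof
    show "C * 2 powr n + 2 powr \<bar>a - n\<bar> * \<omega> > 0" using C by (simp add: add_pos_nonneg)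
    fix y and \<rho> :: real assume y: "0 < \<delta> y" and \<rho>: "0 < \<rho>"
    let ?g = "\<lambda>C. C * \<delta> y powr (a - n) * \<rho> powr n"
    show "emeasure (below_measure a c (\<delta> y)) (cball y \<rho>) \<le> ennreal (?g (C * 2 powr n + 2 powr \<bar>a - n\<bar> * \<omega>))"
    proof (cases "\<rho> \<le> \<delta> y / 2")
      case True
      have near: "\<delta> x powr (a - n) \<le> 2 powr \<bar>a - n\<bar> * \<delta> y powr (a - n)" if "x \<in> cball y \<rho>" for x
      proof (cases "a \<ge> n")
        case True
        have "\<delta> x \<le> 2 * \<delta> y" using that \<open>\<rho> \<le> \<delta> y / 2\<close> y dist_triangle_le[of x y] by (auto simp: dist_commute)
        then have "\<delta> x powr (a - n) \<le> (2 * \<delta> y) powr (a - n)"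
          using True by (intro powr_mono2) (auto simp: infdist_nonneg)
        then show ?thesis using True y by (simp add: powr_mult)
      next
        case False
        have "\<delta> y / 2 \<le> \<delta> x" using that \<open>\<rho> \<le> \<delta> y / 2\<close> y dist_triangle_le[of y x] by (auto simp: dist_commute)
        then have "\<delta> x powr (a - n) \<le> (\<delta> y / 2) powr (a - n)"
          using False y by (intro powr_mono2') auto
        also have "\<dots> = 2 powr (n - a) * \<delta> y powr (a - n)"
          using y powr_minus[of 2 "n - a"] by (simp add: powr_divide field_simps)
        finally show ?thesis using False by simp
      qed
      have "emeasure (below_measure a c (\<delta> y)) (cball y \<rho>)
        \<le> (\<integral>\<^sup>+x. ennreal (2 powr \<bar>a - n\<bar> * \<delta> y powr (a - n)) * indicator (cball y \<rho>) x \<partial>lborel)"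
        by (subst emeasure_below_measure)
          (auto intro!: nn_integral_mono ennreal_leI near simp: indicator_def simp del: mem_cball)
      also have "\<dots> = ennreal (?g (2 powr \<bar>a - n\<bar> * \<omega>))"
        using \<rho> by (subst nn_integral_cmult_indicator) (auto simp: emeasure_cball_powr ac_simps simp flip: ennreal_mult)
      also have "\<dots> \<le> ennreal (?g (C * 2 powr n + 2 powr \<bar>a - n\<bar> * \<omega>))"
        using C by (intro ennreal_leI mult_right_mono) auto
      finally show ?thesis .
    next
      case False
      have "emeasure (below_measure a c (\<delta> y)) (cball y \<rho>) \<le> emeasure (below_measure a c (\<delta> y)) (cball y (2 * \<rho>))"
        using \<rho> by (intro emeasure_mono) auto
      also have "\<dots> \<le> ennreal (C * \<delta> y powr (a - d) * (2 * \<rho>) powr d)"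
        using False y by (intro C) auto
      also have "C * \<delta> y powr (a - d) * (2 * \<rho>) powr d = C * \<delta> y powr a * (2 * \<rho> / \<delta> y) powr d"
        using y \<rho> by (simp add: powr_diff powr_divide)
      also have "\<dots> \<le> C * \<delta> y powr a * (2 * \<rho> / \<delta> y) powr n"
        using y \<rho> C False d_less_n by (intro mult_left_mono powr_mono) (auto simp: field_simps)
      also have "\<dots> = ?g (C * 2 powr n)"
        using y \<rho> by (simp add: powr_diff powr_divide powr_mult)
      also have "\<dots> \<le> ?g (C * 2 powr n + 2 powr \<bar>a - n\<bar> * \<omega>)"
        by (intro mult_right_mono) auto
      finally show ?thesis using C by (simp add: ennreal_leI)
    qed
  qed
qed

end

context thin_set
begin

section \<open>Rays that avoid a thin set\<close>

text \<open>
  A tube of width \<open>h\<close> around a segment is covered by \<open>O(1 / h)\<close> balls of radius \<open>2 * h\<close>. The value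
  \<open>v = 0\<close> is admitted because \<open>v\<close> will be the sign of a difference of points.
\<close>

lemma thin_tube:
  fixes v :: 'a
  assumes h: "0 < h" "h \<le> 1" and v: "norm v = 1 \<or> v = 0"
  obtains T where "T \<in> sets borel"
    "\<And>u \<tau>. norm u \<le> 3 \<Longrightarrow> 0 \<le> \<tau> \<Longrightarrow> dist u (\<tau> *\<^sub>R v) \<le> h \<Longrightarrow> u \<in> T"
    "emeasure lborel T \<le> ennreal (5 * 2 powr n * \<omega> * h powr (n - 1))"
proof
  let ?S = "(\<lambda>k. (real k * h) *\<^sub>R v) ` {..nat \<lfloor>4 / h\<rfloor>}"
  let ?T = "\<Union>w\<in>?S. cball w (2 * h)"
  have fin: "finite ?S" by simp
  show "?T \<in> sets borel" by (intro borel_closed closed_UN) auto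
  fix u \<tau> assume u: "norm u \<le> 3" "0 \<le> \<tau>" "dist u (\<tau> *\<^sub>R v) \<le> h"
  show "u \<in> ?T"
  proof (cases "v = 0")
    case True
    with u h show ?thesis by (auto simp: dist_norm)
  next
    case False
    with v have v1: "norm v = 1" by auto
    have "\<tau> = norm (\<tau> *\<^sub>R v)" using v1 u by simp
    also have "\<dots> \<le> norm u + dist u (\<tau> *\<^sub>R v)"
      by (metis dist_commute dist_norm norm_triangle_sub)
    finally have "\<tau> \<le> 4" using u h by linarith
    define k where "k = nat \<lfloor>\<tau> / h\<rfloor>"
    have k: "k \<le> nat \<lfloor>4 / h\<rfloor>" unfolding k_def using \<open>\<tau> \<le> 4\<close> h
      by (intro nat_mono floor_mono divide_right_mono) auto
    have "real k = of_int \<lfloor>\<tau> / h\<rfloor>" using u h by (simp add: k_def)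
    then have "real k \<le> \<tau> / h" "\<tau> / h \<le> real k + 1" by linarith+
    then have kh: "\<bar>\<tau> - real k * h\<bar> \<le> h" using h by (simp add: field_simps abs_le_iff)
    have dd: "dist (\<tau> *\<^sub>R v) ((real k * h) *\<^sub>R v) = \<bar>\<tau> - real k * h\<bar>"
      using v1 by (simp add: dist_norm flip: scaleR_left_diff_distrib)
    then have "dist ((real k * h) *\<^sub>R v) u \<le> 2 * h"
      using kh u(3) dd dist_triangle[of "(real k * h) *\<^sub>R v" u "\<tau> *\<^sub>R v"]
        dist_commute[of u "\<tau> *\<^sub>R v"] dist_commute[of "(real k * h) *\<^sub>R v" "\<tau> *\<^sub>R v"] by linarith
    then show ?thesis using k by auto
  qed
next
  let ?S = "(\<lambda>k. (real k * h) *\<^sub>R v) ` {..nat \<lfloor>4 / h\<rfloor>}"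
  have "real (card ?S) \<le> real (nat \<lfloor>4 / h\<rfloor>) + 1"
    using card_image_le[of "{..nat \<lfloor>4 / h\<rfloor>}" "\<lambda>k. (real k * h) *\<^sub>R v"] by simp
  also have "\<dots> \<le> 4 / h + 1" using h by simp
  also have "\<dots> \<le> 5 / h" using h by (simp add: field_simps)
  finally have card: "real (card ?S) \<le> 5 / h" .
  have "emeasure lborel (\<Union>w\<in>?S. cball w (2 * h)) \<le> (\<Sum>w\<in>?S. emeasure lborel (cball w (2 * h)))"
    by (intro emeasure_subadditive_finite) auto
  also have "\<dots> = ennreal (real (card ?S) * (\<omega> * (2 * h) powr n))"
    using h by (simp add: emeasure_cball_powr ennreal_mult ennreal_of_nat_eq_real_of_nat)
  also have "\<dots> \<le> ennreal (5 / h * (\<omega> * (2 * h) powr n))"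
    by (intro ennreal_leI mult_right_mono card) auto
  also have "5 / h * (\<omega> * (2 * h) powr n) = 5 * 2 powr n * \<omega> * h powr (n - 1)"
    using h by (simp add: powr_diff powr_mult)
  finally show "emeasure lborel (\<Union>w\<in>?S. cball w (2 * h)) \<le> ennreal (5 * 2 powr n * \<omega> * h powr (n - 1))" .
qed

text \<open>
  A ray from \<open>x\<close> that meets the neighbourhood of \<open>E\<close> of width \<open>c * \<delta> x\<close> at a distance of order
  \<open>2 ^ j * \<delta> x\<close> passes close to one of the \<open>O((2 ^ j / c) powr d)\<close> centres of a covering of \<open>E\<close> by
  balls of radius \<open>c * \<delta> x\<close>. Its direction then lies in a tube of width \<open>12 * c / 2 ^ j\<close> around the
  direction of this centre. The volumes of all these tubes add up to a convergent series
  as \<open>d < n - 1\<close>, and its sum is small together with \<open>c\<close>.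

  Directions are parametrized by the ball of radius \<open>1\<close> around \<open>e\<close>, on which \<open>1 \<le> norm u \<le> 3\<close>, rather
  than by the unit sphere: the changes of variables below are then affine.
\<close>

lemma bad_directions_le:
  assumes e: "norm (e::'a) = 2" and c: "0 < c" "c \<le> 1/12" and x: "x \<notin> E"
  shows "emeasure lborel {u\<in>ball e 1. \<exists>t>0. \<delta> (x + t *\<^sub>R u) < c * \<delta> x}
     \<le> ennreal (K * 3 powr d * 5 * 2 powr n * \<omega> * 12 powr (n - 1) / (1 - 2 powr (-(n - 1 - d))) * c powr (n - 1 - d))"
proof -
  let ?bad = "{u\<in>ball e 1. \<exists>t>0. \<delta> (x + t *\<^sub>R u) < c * \<delta> x}"
  define D where "D = \<delta> x"
  have D: "D > 0" using x dist_pos_iff by (simp add: D_def)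
  obtain z where z: "z \<in> E" "\<delta> x = dist x z" by (rule nearest_point)
  define h where "h j = 12 * c / 2 ^ j" for j :: nat
  have h: "0 < h j" "h j \<le> 1" for j
  proof -
    show "0 < h j" using c by (simp add: h_def)
    have "12 * c \<le> 1 * 2 ^ j" using c one_le_power[of "2::real" j] by linarith
    then show "h j \<le> 1" by (simp add: h_def)
  qed
  have "\<exists>F\<subseteq>E. finite F \<and> real (card F) \<le> K * (3 * 2 ^ j * D / (c * D)) powr d \<and>
       E \<inter> ball z (3 * 2 ^ j * D) \<subseteq> (\<Union>y\<in>F. ball y (c * D))" for j :: nat
  proof -
    have "c * 1 \<le> 3 * 2 ^ j" using c by (intro mult_mono) (auto intro: order_trans)
    then have "c * D \<le> 3 * 2 ^ j * D" using D by (intro mult_right_mono) auto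
    moreover have "0 < c * D" using c D by simp
    ultimately show ?thesis
      using cover[unfolded assouad_cover_def, rule_format, OF z(1)] by blast
  qed
  then obtain F where F: "\<And>j::nat. finite (F j)" "\<And>j. real (card (F j)) \<le> K * (3 * 2 ^ j * D / (c * D)) powr d"
     "\<And>j. E \<inter> ball z (3 * 2 ^ j * D) \<subseteq> (\<Union>y\<in>F j. ball y (c * D))"
    by metis
  have "\<exists>T. T \<in> sets borel \<and> (\<forall>u \<tau>. norm u \<le> 3 \<longrightarrow> 0 \<le> \<tau> \<longrightarrow> dist u (\<tau> *\<^sub>R sgn (y - x)) \<le> h j \<longrightarrow> u \<in> T) \<and>
    emeasure lborel T \<le> ennreal (5 * 2 powr n * \<omega> * h j powr (n - 1))" for y j
    using thin_tube[OF h, of "sgn (y - x)" j] by (metis norm_sgn sgn_zero_iff)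
  then obtain T where T: "\<And>y j. T y j \<in> sets borel"
    "\<And>y j u \<tau>. norm u \<le> 3 \<Longrightarrow> 0 \<le> \<tau> \<Longrightarrow> dist u (\<tau> *\<^sub>R sgn (y - x)) \<le> h j \<Longrightarrow> u \<in> T y j"
    "\<And>y j. emeasure lborel (T y j) \<le> ennreal (5 * 2 powr n * \<omega> * h j powr (n - 1))"
    by metis
  have "?bad \<subseteq> (\<Union>j. \<Union>y\<in>F j. T y j)"
  proof
    fix u assume "u \<in> ?bad"
    then obtain t where u: "dist e u < 1" and t: "t > 0" "\<delta> (x + t *\<^sub>R u) < c * D" by (auto simp: D_def)
    \<comment> \<open>\<open>q\<close> is the obstacle; it lies at distance at least \<open>\<delta> x\<close> from \<open>x\<close>, so \<open>t\<close> cannot be small.\<close>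
    obtain q where q: "q \<in> E" "\<delta> (x + t *\<^sub>R u) = dist (x + t *\<^sub>R u) q" by (rule nearest_point)
    have nu: "norm u \<le> 3" "1 \<le> norm u"
      using u e norm_triangle_ineq3[of e u] by (auto simp: dist_norm)
    have "D \<le> dist x q" unfolding D_def using q by (intro infdist_le)
    also have "\<dots> \<le> dist x (x + t *\<^sub>R u) + dist (x + t *\<^sub>R u) q" by (rule dist_triangle)
    also have "dist x (x + t *\<^sub>R u) = t * norm u" using t by (simp add: dist_norm)
    finally have "D \<le> t * norm u + c * D" using t q by linarith
    also have "\<dots> \<le> t * 3 + 1/12 * D" using nu t c D by (intro add_mono mult_mono) auto
    finally have tD: "D / 6 \<le> t" using D by simp
    obtain j0 where "6 * t / D < 2 ^ j0" using real_arch_pow[of 2 "6 * t / D"] by auto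
    then have ex: "t < D / 6 * 2 ^ j0" using D by (simp add: field_simps)
    define i where "i = (LEAST j. t < D / 6 * 2 ^ j)"
    have i: "t < D / 6 * 2 ^ i" unfolding i_def by (rule LeastI[of _ j0]) (rule ex)
    then have "i \<noteq> 0" using tD by (intro notI) simp
    then obtain j where j: "i = Suc j" by (cases i) auto
    have jl: "D / 6 * 2 ^ j \<le> t" using not_less_Least[of j "\<lambda>j. t < D / 6 * 2 ^ j"] j by (simp add: i_def)
    have ju: "t < D / 3 * 2 ^ j" using i j by simp
    have "dist z q \<le> dist z x + dist x (x + t *\<^sub>R u) + dist (x + t *\<^sub>R u) q"
      by (metis add_mono_thms_linordered_semiring(3) dist_triangle order_trans)
    also have "\<dots> \<le> D + t * norm u + c * D"
      using z q t by (simp add: D_def dist_commute dist_norm)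
    also have "\<dots> \<le> D + t * 3 + 1/12 * D" using nu t c D by (intro add_mono mult_mono) auto
    also have "\<dots> < 3 * 2 ^ j * D"
    proof -
      have "D \<le> 2 ^ j * D" using D by simp
      moreover have "t * 3 < 2 ^ j * D" using ju by (simp add: field_simps)
      ultimately show ?thesis using D by linarith
    qed
    finally have "q \<in> E \<inter> ball z (3 * 2 ^ j * D)" using q by simp
    then obtain y where y: "y \<in> F j" "dist y q < c * D" using F(3) by fastforce
    \<comment> \<open>Scaling the ray by \<open>1 / t\<close> turns closeness to the centre \<open>y\<close> into closeness of directions.\<close>
    have "dist u ((1/t) *\<^sub>R (y - x)) = dist (x + t *\<^sub>R u) y / t"
    proof -
      have "u - (1/t) *\<^sub>R (y - x) = (1/t) *\<^sub>R (x + t *\<^sub>R u - y)"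
        using t by (simp add: algebra_simps)
      then show ?thesis using t by (simp add: dist_norm)
    qed
    also have "\<dots> \<le> 2 * c * D / t"
      using y t q dist_triangle[of "x + t *\<^sub>R u" y q] by (intro divide_right_mono) (auto simp: dist_commute)
    also have "\<dots> \<le> 2 * c * D / (D / 6 * 2 ^ j)"
      using jl D c t by (intro divide_left_mono) auto
    also have "\<dots> = h j" using D by (simp add: h_def field_simps)
    finally have "dist u ((1/t) *\<^sub>R (y - x)) \<le> h j" .
    moreover have "(1/t) *\<^sub>R (y - x) = (norm (y - x) / t) *\<^sub>R sgn (y - x)"
      by (cases "y = x") (auto simp: sgn_div_norm divide_inverse)
    ultimately have "u \<in> T y j" using nu t T(2)[of u "norm (y - x) / t" y j] by simp
    with y show "u \<in> (\<Union>j. \<Union>y\<in>F j. T y j)" by blast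
  qed
  moreover have Tm: "(\<Union>y\<in>F j. T y j) \<in> sets lborel" for j
    using T(1) F(1) by (intro sets.finite_UN) auto
  then have "(\<Union>j. \<Union>y\<in>F j. T y j) \<in> sets lborel" by blast
  ultimately have "emeasure lborel ?bad \<le> emeasure lborel (\<Union>j. \<Union>y\<in>F j. T y j)"
    by (intro emeasure_mono)
  also have "\<dots> \<le> (\<Sum>j. emeasure lborel (\<Union>y\<in>F j. T y j))"
    using Tm by (intro emeasure_subadditive_countably) auto
  also have "\<dots> \<le> (\<Sum>j. ennreal (K * 3 powr d * 5 * 2 powr n * \<omega> * 12 powr (n - 1) * c powr (n - 1 - d) * (2 powr (-(n - 1 - d))) ^ j))"
  proof (intro suminf_le allI)
    fix j
    have "emeasure lborel (\<Union>y\<in>F j. T y j) \<le> (\<Sum>y\<in>F j. emeasure lborel (T y j))"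
      using T F by (intro emeasure_subadditive_finite) auto
    also have "\<dots> \<le> (\<Sum>y\<in>F j. ennreal (5 * 2 powr n * \<omega> * h j powr (n - 1)))"
      by (intro sum_mono T)
    also have "\<dots> = ennreal (real (card (F j)) * (5 * 2 powr n * \<omega> * h j powr (n - 1)))"
      by (simp add: ennreal_mult ennreal_of_nat_eq_real_of_nat)
    also have "\<dots> \<le> ennreal (K * (3 * 2 ^ j * D / (c * D)) powr d * (5 * 2 powr n * \<omega> * h j powr (n - 1)))"
      by (intro ennreal_leI mult_right_mono F) auto
    also have "K * (3 * 2 ^ j * D / (c * D)) powr d * (5 * 2 powr n * \<omega> * h j powr (n - 1))
      = K * 3 powr d * 5 * 2 powr n * \<omega> * 12 powr (n - 1) * c powr (n - 1 - d) * (2 powr (-(n - 1 - d))) ^ j"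
    proof -
      have p: "((2::real) ^ j) powr b = (2 powr b) ^ j" for b
        by (simp add: powr_powr mult.commute flip: powr_realpow)
      have q: "(2 powr (-(n - 1 - d)))^j = (2 powr d) ^ j / (2 powr (n - 1)) ^ j"
        by (simp add: power_divide[symmetric] flip: powr_diff)
      have A1: "h j powr (n - 1) = 12 powr (n - 1) * c powr (n - 1) / (2 powr (n - 1)) ^ j"
        using c by (simp add: h_def powr_divide powr_mult p)
      have A2: "(3 * 2 ^ j * D / (c * D)) powr d = 3 powr d * (2 powr d) ^ j / c powr d"
        using c D by (simp add: powr_divide powr_mult p)
      have A3: "c powr (n - 1 - d) = c powr (n - 1) / c powr d" by (rule powr_diff)
      show ?thesis unfolding A1 A2 A3 q by (simp add: ac_simps)
    qed
    finally show "emeasure lborel (\<Union>y\<in>F j. T y j) \<le> \<dots>" .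
  qed auto
  also have "\<dots> = ennreal (K * 3 powr d * 5 * 2 powr n * \<omega> * 12 powr (n - 1) * c powr (n - 1 - d) * (1 / (1 - 2 powr (-(n - 1 - d)))))"
  proof -
    have "(2::real) powr (-(n - 1 - d)) < 1"
      using d_less powr_less_mono[of "-(n-1-d)" 0 "2::real"] by simp
    then show ?thesis using K_pos
      by (intro suminf_ennreal_eq sums_mult geometric_sums) auto
  qed
  finally show ?thesis by (simp add: ac_simps)
qed

lemma few_bad_directions:
  assumes e: "norm (e::'a) = 2"
  obtains c where "0 < c" "c \<le> 1"
    "\<And>x. x \<notin> E \<Longrightarrow> emeasure lborel {u\<in>ball e 1. \<exists>t>0. \<delta> (x + t *\<^sub>R u) < c * \<delta> x} \<le> ennreal (\<omega> / 2)"
proof -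
  define M where "M = K * 3 powr d * 5 * 2 powr n * \<omega> * 12 powr (n - 1) / (1 - 2 powr (-(n - 1 - d)))"
  define \<epsilon> where "\<epsilon> = n - 1 - d"
  have \<epsilon>: "\<epsilon> > 0" using d_less by (simp add: \<epsilon>_def)
  have "(2::real) powr (-(n - 1 - d)) < 1"
    using d_less powr_less_mono[of "-(n-1-d)" 0 "2::real"] by simp
  then have M: "M > 0" using K_pos unfolding M_def by (intro divide_pos_pos mult_pos_pos) auto
  define c where "c = min (1/12) ((\<omega> / (2 * M)) powr (1 / \<epsilon>))"
  have c: "0 < c" "c \<le> 1/12" using M by (auto simp: c_def less_imp_neq[OF ball_vol_pos(1), symmetric])
  have "c powr \<epsilon> \<le> ((\<omega> / (2 * M)) powr (1 / \<epsilon>)) powr \<epsilon>"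
    using c \<epsilon> by (intro powr_mono2) (auto simp: c_def)
  also have "\<dots> = \<omega> / (2 * M)" using \<epsilon> M by (simp add: powr_powr)
  finally have "M * c powr \<epsilon> \<le> \<omega> / 2" using M by (simp add: field_simps)
  then show ?thesis
    using that[of c] c bad_directions_le[OF e c] unfolding M_def \<epsilon>_def
    by (meson ennreal_leI order_trans order_less_imp_le divide_le_eq_1_pos zero_less_numeral one_le_numeral)
qed

end

section \<open>Integration along rays\<close>

lemma has_real_derivative_pos_part_powr:
  fixes s :: real
  assumes "s > 1"
  shows "((\<lambda>w. max 0 w powr s) has_real_derivative s * max 0 w powr (s - 1)) (at w)"
proof -
  consider "w > 0" | "w < 0" | "w = 0" by linarith
  then show ?thesis
  proof cases
    case 1
    have "((\<lambda>w. w powr s) has_real_derivative s * w powr (s - 1)) (at w)"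
      using 1 by (rule has_real_derivative_powr)
    then have "((\<lambda>w. max 0 w powr s) has_real_derivative s * w powr (s - 1)) (at w)"
      by (rule has_field_derivative_transform_within_open[where S="{0<..}"]) (use 1 in auto)
    then show ?thesis using 1 by simp
  next
    case 2
    have "((\<lambda>w. 0) has_real_derivative 0) (at w)" by simp
    then have "((\<lambda>w. max 0 w powr s) has_real_derivative 0) (at w)"
      by (rule has_field_derivative_transform_within_open[where S="{..<0}"]) (use 2 in auto)
    then show ?thesis using 2 by simp
  next
    case 3
    have "((\<lambda>h::real. max 0 h powr s / h) \<longlongrightarrow> 0) (at 0)"
    proof (rule Lim_null_comparison)
      show "\<forall>\<^sub>F h in at 0. norm (max 0 h powr s / h) \<le> \<bar>h\<bar> powr (s - 1)"
        by (rule always_eventually) (auto simp: max_def powr_diff divide_nonneg_neg)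
      show "((\<lambda>h::real. \<bar>h\<bar> powr (s - 1)) \<longlongrightarrow> 0) (at 0)"
        using assms by (auto intro!: tendsto_eq_intros)
    qed
    then show ?thesis using 3 by (simp add: DERIV_def)
  qed
qed

text \<open>
  A \<open>C\<^sup>1\<close> function that vanishes below \<open>1\<close>, equals \<open>1/2\<close> above \<open>2\<close> and has slope at most \<open>1\<close>;
  \<open>smooth_step'\<close> is its derivative. Composing with it localizes the gradient to a band of values.
\<close>

definition smooth_step :: "real \<Rightarrow> real" where
  "smooth_step v = max 0 (v - 1) powr 2 - 2 * max 0 (v - 3/2) powr 2 + max 0 (v - 2) powr 2"

definition smooth_step' :: "real \<Rightarrow> real" where
  "smooth_step' v = 2 * max 0 (v - 1) - 4 * max 0 (v - 3/2) + 2 * max 0 (v - 2)"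

lemma smooth_step_deriv: "(smooth_step has_real_derivative smooth_step' v) (at v)"
proof -
  have sh: "((\<lambda>v. max 0 (v - a) powr 2) has_real_derivative 2 * max 0 (v - a)) (at v)" for a :: real
    using DERIV_shift[of "\<lambda>w. max 0 w powr 2" "2 * max 0 (v - a)" v "-a"]
      has_real_derivative_pos_part_powr[of 2 "v - a"] by simp
  have "(smooth_step has_real_derivative 2 * max 0 (v - 1) - 2 * (2 * max 0 (v - 3/2)) + 2 * max 0 (v - 2)) (at v)"
    unfolding smooth_step_def by (intro DERIV_add DERIV_diff DERIV_cmult sh)
  then show ?thesis by (simp add: smooth_step'_def)
qed

lemma smooth_step_zero: "v \<le> 1 \<Longrightarrow> smooth_step v = 0"
  and smooth_step_ge: "v \<ge> 2 \<Longrightarrow> smooth_step v = 1/2"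
  and smooth_step'_bound: "\<bar>smooth_step' v\<bar> \<le> 1"
  and smooth_step'_supp: "smooth_step' v \<noteq> 0 \<Longrightarrow> 1 < v \<and> v < 2"
proof -
  show "v \<le> 1 \<Longrightarrow> smooth_step v = 0" by (simp add: smooth_step_def)
  show "v \<ge> 2 \<Longrightarrow> smooth_step v = 1/2"
    by (simp add: smooth_step_def max_def) (simp add: power2_eq_square algebra_simps)
  show "\<bar>smooth_step' v\<bar> \<le> 1" "smooth_step' v \<noteq> 0 \<Longrightarrow> 1 < v \<and> v < 2"
    by (auto simp: smooth_step'_def max_def split: if_splits)
qed

text \<open>
  The compact set \<open>X\<close> only has to contain the support of \<open>f\<close>, so that the functions derived from \<open>f\<close> share it.
\<close>

locale C1_function =
  fixes f :: "'a::euclidean_space \<Rightarrow> real" and g :: "'a \<Rightarrow> 'a" and X :: "'a set"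
  assumes deriv: "\<And>x. (f has_derivative (\<lambda>v. g x \<bullet> v)) (at x)"
    and cont_g: "continuous_on UNIV g"
    and compact_X: "compact X" and supp: "\<And>x. x \<notin> X \<Longrightarrow> f x = 0"
begin

lemma cont_f: "continuous_on UNIV f"
  using deriv by (meson continuous_at_imp_continuous_on has_derivative_continuous)

lemma f_measurable [measurable]: "f \<in> borel_measurable borel"
  and g_measurable [measurable]: "g \<in> borel_measurable borel"
  using cont_f cont_g by (auto intro: borel_measurable_continuous_onI)

definition band :: "real \<Rightarrow> 'a \<Rightarrow> ennreal" where
  "band b y = indicator {y. b < \<bar>f y\<bar> \<and> \<bar>f y\<bar> < 2 * b} y * ennreal (norm (g y))"

lemma band_measurable [measurable]: "band b \<in> borel_measurable borel"
  unfolding band_def by measurable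

text \<open>
  Along the ray the function descends from at least \<open>2 * b\<close> to \<open>0\<close>, hence it crosses the band between
  \<open>b\<close> and \<open>2 * b\<close>. The fundamental theorem of calculus is applied to the smooth step of \<open>f / b\<close>, which
  ignores the rest of the ray. The factor \<open>6\<close> is \<open>2 * 3\<close>: the step has height \<open>1/2\<close> and \<open>norm u \<le> 3\<close>.
\<close>

lemma ray_bound_pos:
  assumes b: "b > 0" "f x \<ge> 2 * b" and u: "1 \<le> norm u" "norm u \<le> 3"
  shows "ennreal b \<le> (\<integral>\<^sup>+t. indicator {0<..} t * (6 * band b (x + t *\<^sub>R u)) \<partial>lborel)"
proof -
  obtain r where r: "\<And>y. y \<in> X \<Longrightarrow> norm y \<le> r" using compact_imp_bounded[OF compact_X] bounded_iff by blast
  define T where "T = \<bar>r\<bar> + norm x + 1"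
  have T: "T > 0" by (simp add: T_def add_nonneg_pos)
  have "x + T *\<^sub>R u \<notin> X"
  proof
    assume "x + T *\<^sub>R u \<in> X"
    then have "norm (x + T *\<^sub>R u) \<le> r" by (rule r)
    moreover have "norm (T *\<^sub>R u) \<le> norm (x + T *\<^sub>R u) + norm x"
      by (metis add.commute add_diff_cancel_left' norm_triangle_ineq4)
    moreover have "T \<le> norm (T *\<^sub>R u)" using T u by simp
    moreover have "T = \<bar>r\<bar> + norm x + 1" by (rule T_def)
    ultimately show False by linarith
  qed
  then have fT: "f (x + T *\<^sub>R u) = 0" by (rule supp)
  define k where "k t = f (x + t *\<^sub>R u) / b" for t
  define k' where "k' t = (g (x + t *\<^sub>R u) \<bullet> u) / b" for t
  have dk: "(k has_real_derivative k' t) (at t)" for t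
  proof -
    have "((\<lambda>t. x + t *\<^sub>R u) has_derivative (\<lambda>h. h *\<^sub>R u)) (at t)"
      by (auto intro!: derivative_eq_intros)
    then have "((\<lambda>t. f (x + t *\<^sub>R u)) has_derivative (\<lambda>h. g (x + t *\<^sub>R u) \<bullet> (h *\<^sub>R u))) (at t)"
      by (rule has_derivative_compose) (rule deriv)
    then have "((\<lambda>t. f (x + t *\<^sub>R u)) has_real_derivative g (x + t *\<^sub>R u) \<bullet> u) (at t)"
      by (simp add: has_field_derivative_def mult_commute_abs)
    then show ?thesis unfolding k_def k'_def by (rule DERIV_cdivide)
  qed
  define h where "h t = smooth_step' (k t) * k' t" for t
  have dstep: "((\<lambda>t. smooth_step (k t)) has_real_derivative h t) (at t)" for t
    unfolding h_def by (rule DERIV_chain2[OF smooth_step_deriv dk])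
  have ck: "continuous_on A k" for A
    using dk by (meson DERIV_isCont continuous_at_imp_continuous_on)
  have ck': "continuous_on A k'" for A
    unfolding k'_def
    by (intro continuous_intros continuous_on_compose2[OF cont_g]) (use b in auto)
  have ch: "continuous_on A h" for A
    unfolding h_def smooth_step'_def by (intro continuous_intros ck ck')
  have I: "(\<integral>t. indicator {0..T} t *\<^sub>R h t \<partial>lborel) = smooth_step (k T) - smooth_step (k 0)"
    using T by (intro integral_FTC_atLeastAtMost ch)
      (auto simp: has_real_derivative_iff_has_vector_derivative[symmetric] intro!: has_field_derivative_at_within dstep)
  have sT: "smooth_step (k T) = 0" using fT by (simp add: k_def smooth_step_zero)
  have s0: "smooth_step (k 0) = 1/2" using b by (intro smooth_step_ge) (simp add: k_def field_simps)
  have "ennreal (1/2) = ennreal (norm (\<integral>t. indicator {0..T} t *\<^sub>R h t \<partial>lborel))"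
    unfolding I sT s0 by simp
  also have "\<dots> \<le> (\<integral>\<^sup>+t. ennreal (norm (indicator {0..T} t *\<^sub>R h t)) \<partial>lborel)"
    by (rule integral_norm_bound_ennreal) (intro borel_integrable_compact ch compact_Icc)
  also have "\<dots> \<le> (\<integral>\<^sup>+t. ennreal (3 / b) * (indicator {0<..} t * band b (x + t *\<^sub>R u)) \<partial>lborel)"
  proof (rule nn_integral_mono_AE)
    have "AE t in lborel. t \<noteq> (0::real)" by (rule AE_lborel_singleton)
    then show "AE t in lborel. ennreal (norm (indicator {0..T} t *\<^sub>R h t))
      \<le> ennreal (3 / b) * (indicator {0<..} t * band b (x + t *\<^sub>R u))"
    proof eventually_elim
      case (elim t)
      show ?case
      proof (cases "0 < t \<and> t \<le> T \<and> smooth_step' (k t) \<noteq> 0")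
        case True
        then have "1 < k t" "k t < 2" using smooth_step'_supp by auto
        then have bd: "b < f (x + t *\<^sub>R u)" "f (x + t *\<^sub>R u) < 2 * b"
          using b by (auto simp: k_def field_simps)
        have "\<bar>h t\<bar> \<le> 1 * (3 / b * norm (g (x + t *\<^sub>R u)))"
          unfolding h_def abs_mult
        proof (intro mult_mono smooth_step'_bound)
          have "\<bar>g (x + t *\<^sub>R u) \<bullet> u\<bar> \<le> norm (g (x + t *\<^sub>R u)) * norm u" by (rule Cauchy_Schwarz_ineq2)
          also have "\<dots> \<le> norm (g (x + t *\<^sub>R u)) * 3" using u by (intro mult_left_mono) auto
          finally show "\<bar>k' t\<bar> \<le> 3 / b * norm (g (x + t *\<^sub>R u))" using b by (simp add: k'_def field_simps)
        qed auto
        then have "ennreal \<bar>h t\<bar> \<le> ennreal (3 / b) * ennreal (norm (g (x + t *\<^sub>R u)))"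
          using b by (simp add: ennreal_leI flip: ennreal_mult)
        then show ?thesis using True bd b by (simp add: band_def)
      qed (use elim in \<open>auto simp: h_def indicator_def\<close>)
    qed
  qed
  also have "\<dots> = ennreal (3 / b) * (\<integral>\<^sup>+t. indicator {0<..} t * band b (x + t *\<^sub>R u) \<partial>lborel)"
    by (rule nn_integral_cmult) measurable
  finally have "ennreal (2 * b) * ennreal (1/2) \<le> ennreal (2 * b) * (ennreal (3 / b) * (\<integral>\<^sup>+t. indicator {0<..} t * band b (x + t *\<^sub>R u) \<partial>lborel))"
    by (rule mult_left_mono) simp
  moreover have "ennreal (2 * b) * ennreal (1/2) = ennreal b" using b by (subst ennreal_mult[symmetric]) auto
  moreover have "ennreal (2 * b) * (ennreal (3 / b) * Z) = 6 * Z" for Z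
    using b by (simp flip: ennreal_mult mult.assoc)
  moreover have "(\<integral>\<^sup>+t. indicator {0<..} t * (6 * band b (x + t *\<^sub>R u)) \<partial>lborel)
     = 6 * (\<integral>\<^sup>+t. indicator {0<..} t * band b (x + t *\<^sub>R u) \<partial>lborel)"
    by (subst nn_integral_cmult[symmetric]) (auto intro!: nn_integral_cong simp: ac_simps)
  ultimately show ?thesis by simp
qed

lemma C1_function_uminus: "C1_function (\<lambda>x. - f x) (\<lambda>x. - g x) X"
proof
  show "((\<lambda>x. - f x) has_derivative (\<lambda>v. - g x \<bullet> v)) (at x)" for x
    using has_derivative_minus[OF deriv] by simp
qed (use supp compact_X cont_g in \<open>auto intro: continuous_intros\<close>)

lemma ray_bound:
  assumes b: "b > 0" "\<bar>f x\<bar> \<ge> 2 * b" and u: "1 \<le> norm u" "norm u \<le> 3"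
  shows "ennreal b \<le> (\<integral>\<^sup>+t. indicator {0<..} t * (6 * band b (x + t *\<^sub>R u)) \<partial>lborel)"
proof (cases "f x \<ge> 0")
  case True
  with assms show ?thesis by (intro ray_bound_pos) auto
next
  case False
  interpret minus: C1_function "\<lambda>x. - f x" "\<lambda>x. - g x" X by (rule C1_function_uminus)
  have "minus.band b = band b" by (auto simp: minus.band_def band_def fun_eq_iff)
  with False assms minus.ray_bound_pos[of b x u] show ?thesis by auto
qed

end

text \<open>
  Integrating along all rays from \<open>x\<close> gives a Riesz potential: for fixed \<open>t\<close> substitute \<open>y = x + t *\<^sub>R u\<close>.
  Only the \<open>t\<close> between \<open>dist x y / 3\<close> and \<open>dist x y\<close> lead to a given \<open>y\<close>, and the Jacobian
  \<open>t powr (- n)\<close> is of order \<open>dist x y powr (- n)\<close> for them.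
\<close>

lemma nn_integral_cone_le:
  fixes W :: "'a::euclidean_space \<Rightarrow> ennreal" and e x :: 'a
  assumes [measurable]: "W \<in> borel_measurable borel" and e: "norm e = 2"
  shows "(\<integral>\<^sup>+u. indicator (ball e 1) u * (\<integral>\<^sup>+t. indicator {0<..} t * W (x + t *\<^sub>R u) \<partial>lborel) \<partial>lborel)
    \<le> ennreal (3 powr real DIM('a)) * (\<integral>\<^sup>+y. W y * ennreal (dist x y powr (1 - real DIM('a))) \<partial>lborel)"
proof -
  let ?n = "real DIM('a)"
  let ?I = "\<lambda>y t. indicator {0<..} t * (ennreal (t powr (-?n)) * indicator (ball e 1) ((1/t) *\<^sub>R (y - x))) :: ennreal"
  have [measurable]: "ball e 1 \<in> sets borel" by simp
  have "(\<integral>\<^sup>+u. indicator (ball e 1) u * (\<integral>\<^sup>+t. indicator {0<..} t * W (x + t *\<^sub>R u) \<partial>lborel) \<partial>lborel)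
    = (\<integral>\<^sup>+u. (\<integral>\<^sup>+t. indicator (ball e 1) u * (indicator {0<..} t * W (x + t *\<^sub>R u)) \<partial>lborel) \<partial>lborel)"
    by (intro nn_integral_cong nn_integral_cmult[symmetric]) measurable
  also have "\<dots> = (\<integral>\<^sup>+t. (\<integral>\<^sup>+u. indicator (ball e 1) u * (indicator {0<..} t * W (x + t *\<^sub>R u)) \<partial>lborel) \<partial>lborel)"
    by (rule lborel_pair.Fubini'[symmetric]) measurable
  also have "\<dots> = (\<integral>\<^sup>+t. (\<integral>\<^sup>+y. W y * ?I y t \<partial>lborel) \<partial>lborel)"
  proof (rule nn_integral_cong)
    fix t :: real
    show "(\<integral>\<^sup>+u. indicator (ball e 1) u * (indicator {0<..} t * W (x + t *\<^sub>R u)) \<partial>lborel) = (\<integral>\<^sup>+y. W y * ?I y t \<partial>lborel)"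
    proof (cases "t > 0")
      case True
      have "(\<integral>\<^sup>+y. W y * ?I y t \<partial>lborel)
        = (\<integral>\<^sup>+y. W y * ?I y t \<partial>density (distr lborel borel (\<lambda>u. x + t *\<^sub>R u)) (\<lambda>_. \<bar>t\<bar>^DIM('a)))"
        using lborel_affine[of t x] True by simp
      also have "\<dots> = (\<integral>\<^sup>+u. ennreal (t ^ DIM('a)) * (W (x + t *\<^sub>R u) * ?I (x + t *\<^sub>R u) t) \<partial>lborel)"
        using True by (subst nn_integral_density) (auto simp: nn_integral_distr)
      also have "\<dots> = (\<integral>\<^sup>+u. indicator (ball e 1) u * (indicator {0<..} t * W (x + t *\<^sub>R u)) \<partial>lborel)"
      proof (rule nn_integral_cong)
        fix u
        have "ennreal (t ^ DIM('a)) * ennreal (t powr (-?n)) = 1"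
          using True by (simp add: powr_minus powr_realpow flip: ennreal_mult)
        then have "ennreal (t ^ DIM('a)) * (ennreal (t powr (-?n)) * Z) = Z" for Z
          by (simp flip: mult.assoc)
        then show "ennreal (t ^ DIM('a)) * (W (x + t *\<^sub>R u) * ?I (x + t *\<^sub>R u) t) = indicator (ball e 1) u * (indicator {0<..} t * W (x + t *\<^sub>R u))"
          using True by (cases "u \<in> ball e 1") (simp_all add: mult.commute[of "W _"])
      qed
      finally show ?thesis ..
    qed simp
  qed
  also have "\<dots> = (\<integral>\<^sup>+y. (\<integral>\<^sup>+t. W y * ?I y t \<partial>lborel) \<partial>lborel)"
    by (rule lborel_pair.Fubini'[symmetric]) measurable
  also have "\<dots> = (\<integral>\<^sup>+y. W y * (\<integral>\<^sup>+t. ?I y t \<partial>lborel) \<partial>lborel)"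
    by (intro nn_integral_cong nn_integral_cmult) measurable
  also have "\<dots> \<le> (\<integral>\<^sup>+y. W y * ennreal (3 powr ?n * dist x y powr (1 - ?n)) \<partial>lborel)"
  proof (intro nn_integral_mono mult_left_mono)
    fix y
    define r where "r = dist x y"
    have "?I y t \<le> ennreal (3 powr ?n * r powr (-?n)) * indicator {r/3..r} t" for t
    proof (cases "t > 0 \<and> (1/t) *\<^sub>R (y - x) \<in> ball e 1")
      case True
      then have "dist e ((1/t) *\<^sub>R (y - x)) < 1" by simp
      then have "1 < norm ((1/t) *\<^sub>R (y - x))" "norm ((1/t) *\<^sub>R (y - x)) < 3"
        using e norm_triangle_ineq3[of e "(1/t) *\<^sub>R (y - x)"] by (auto simp: dist_norm)
      moreover have "norm ((1/t) *\<^sub>R (y - x)) = r / t"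
        using True by (simp add: r_def dist_norm norm_minus_commute)
      ultimately have "1 < r / t" "r / t < 3" by simp_all
      then have tr: "r / 3 \<le> t" "t \<le> r" "r > 0" using True by (auto simp: field_simps)
      have "t powr (-?n) \<le> (r/3) powr (-?n)"
        using tr by (intro powr_mono2') auto
      also have "\<dots> = 3 powr ?n * r powr (-?n)" using tr by (simp add: powr_minus powr_divide field_simps)
      finally show ?thesis using True tr by (simp add: ennreal_leI)
    qed auto
    then have "(\<integral>\<^sup>+t. ?I y t \<partial>lborel) \<le> (\<integral>\<^sup>+t. ennreal (3 powr ?n * r powr (-?n)) * indicator {r/3..r} t \<partial>lborel)"
      by (intro nn_integral_mono)
    also have "\<dots> = ennreal (3 powr ?n * r powr (-?n) * (r - r/3))"
      by (subst nn_integral_cmult_indicator) (auto simp: r_def simp flip: ennreal_mult)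
    also have "\<dots> \<le> ennreal (3 powr ?n * r powr (1 - ?n))"
    proof (cases "r = 0")
      case False
      then have "r > 0" by (simp add: r_def)
      have "3 powr ?n * r powr (-?n) * (r - r/3) \<le> 3 powr ?n * r powr (-?n) * r"
        using \<open>r > 0\<close> by (intro mult_left_mono) auto
      also have "\<dots> = 3 powr ?n * r powr (1 - ?n)"
        using \<open>r > 0\<close> by (simp add: powr_diff powr_minus field_simps)
      finally show ?thesis by (rule ennreal_leI)
    qed auto
    finally show "(\<integral>\<^sup>+t. ?I y t \<partial>lborel) \<le> ennreal (3 powr ?n * dist x y powr (1 - ?n))" by (simp add: r_def)
  qed simp
  also have "\<dots> = (\<integral>\<^sup>+y. ennreal (3 powr ?n) * (W y * ennreal (dist x y powr (1 - ?n))) \<partial>lborel)"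
    by (intro nn_integral_cong) (simp add: ennreal_mult ac_simps)
  also have "\<dots> = ennreal (3 powr ?n) * (\<integral>\<^sup>+y. W y * ennreal (dist x y powr (1 - ?n)) \<partial>lborel)"
    by (rule nn_integral_cmult) measurable
  finally show ?thesis .
qed

section \<open>Potential estimates\<close>

context thin_set
begin

text \<open>
  Averaging \<open>ray_bound\<close> over the good directions at \<open>x\<close> only. Along these every point \<open>y\<close> satisfies
  \<open>c * \<delta> x \<le> \<delta> y\<close>, so the corresponding indicator may be inserted before extending the average to
  all directions.
\<close>

lemma pointwise_bound:
  obtains c C where "0 < c" "c \<le> 1" "0 < C"
    "\<And>f g X b x. C1_function f g X \<Longrightarrow> X \<inter> E = {} \<Longrightarrow> b > 0 \<Longrightarrow> 2 * b \<le> \<bar>f x\<bar> \<Longrightarrow>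
       ennreal b \<le> ennreal C * (\<integral>\<^sup>+y. indicator {y. c * \<delta> x \<le> \<delta> y} y * C1_function.band f g b y *
          ennreal (dist x y powr (1 - n)) \<partial>lborel)"
proof -
  obtain i :: 'a where "i \<in> Basis" using nonempty_Basis by blast
  define e where "e = 2 *\<^sub>R i"
  have e: "norm e = 2" using \<open>i \<in> Basis\<close> by (simp add: e_def)
  obtain c where c: "0 < c" "c \<le> 1" and
    few: "\<And>x. x \<notin> E \<Longrightarrow> emeasure lborel {u\<in>ball e 1. \<exists>t>0. \<delta> (x + t *\<^sub>R u) < c * \<delta> x} \<le> ennreal (\<omega> / 2)"
    using few_bad_directions[OF e] by blast
  show ?thesis
  proof
    show "0 < c" "c \<le> 1" by fact+
    show "12 * 3 powr n / \<omega> > 0" by simp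
    fix f :: "'a \<Rightarrow> real" and g X b x
    assume C1: "C1_function f g X" and XE: "X \<inter> E = {}" and b: "b > 0" "2 * b \<le> \<bar>f x\<bar>"
    interpret C1_function f g X by (rule C1)
    have "x \<notin> E" using supp[of x] XE b by fastforce
    define bad where "bad = {u\<in>ball e 1. \<exists>t>0. \<delta> (x + t *\<^sub>R u) < c * \<delta> x}"
    have "bad = ball e 1 \<inter> (\<Union>t\<in>{0<..}. {u. \<delta> (x + t *\<^sub>R u) < c * \<delta> x})"
      by (auto simp: bad_def)
    also have "open \<dots>"
      by (intro open_Int open_UN ballI open_ball open_Collect_less continuous_intros)
    finally have bad_sets [measurable]: "bad \<in> sets borel" by simp
    have bad_le: "emeasure lborel bad \<le> ennreal (\<omega> / 2)" unfolding bad_def by (rule few) fact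
    have [measurable]: "ball e 1 \<in> sets borel" by simp
    have "ennreal \<omega> = emeasure lborel (ball e 1)" by (simp add: emeasure_ball_powr)
    also have "\<dots> \<le> emeasure lborel (bad \<union> (ball e 1 - bad))" by (intro emeasure_mono) auto
    also have "\<dots> \<le> emeasure lborel bad + emeasure lborel (ball e 1 - bad)"
      by (rule emeasure_subadditive) auto
    also have "\<dots> \<le> ennreal (\<omega> / 2) + emeasure lborel (ball e 1 - bad)"
      by (intro add_right_mono bad_le)
    finally have "ennreal (\<omega> / 2) + ennreal (\<omega> / 2) \<le> ennreal (\<omega> / 2) + emeasure lborel (ball e 1 - bad)"
      by (simp flip: ennreal_plus)
    then have good: "ennreal (\<omega> / 2) \<le> emeasure lborel (ball e 1 - bad)"
      by (simp add: ennreal_add_left_cancel_le)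
    define W where "W y = indicator {y. c * \<delta> x \<le> \<delta> y} y * band b y" for y
    have [measurable]: "W \<in> borel_measurable borel" unfolding W_def by measurable
    have "ennreal b * ennreal (\<omega> / 2) \<le> ennreal b * emeasure lborel (ball e 1 - bad)"
      by (intro mult_left_mono good) simp
    also have "\<dots> = (\<integral>\<^sup>+u. ennreal b * indicator (ball e 1 - bad) u \<partial>lborel)"
      by (subst nn_integral_cmult_indicator) auto
    also have "\<dots> \<le> (\<integral>\<^sup>+u. indicator (ball e 1) u * (\<integral>\<^sup>+t. indicator {0<..} t * (6 * W (x + t *\<^sub>R u)) \<partial>lborel) \<partial>lborel)"
    proof (rule nn_integral_mono)
      fix u
      show "ennreal b * indicator (ball e 1 - bad) u \<le> indicator (ball e 1) u * (\<integral>\<^sup>+t. indicator {0<..} t * (6 * W (x + t *\<^sub>R u)) \<partial>lborel)"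
      proof (cases "u \<in> ball e 1 - bad")
        case True
        have "dist e u < 1" using True by simp
        then have u: "1 \<le> norm u" "norm u \<le> 3"
          using e norm_triangle_ineq3[of e u] by (auto simp: dist_norm)
        have "ennreal b \<le> (\<integral>\<^sup>+t. indicator {0<..} t * (6 * band b (x + t *\<^sub>R u)) \<partial>lborel)"
          by (rule ray_bound[OF b u])
        also have "\<dots> = (\<integral>\<^sup>+t. indicator {0<..} t * (6 * W (x + t *\<^sub>R u)) \<partial>lborel)"
        proof -
          have "c * \<delta> x \<le> \<delta> (x + t *\<^sub>R u)" if "t > 0" for t
          proof (rule ccontr)
            assume "\<not> ?thesis"
            then have "u \<in> bad" using True that unfolding bad_def by force
            with True show False by simp
          qed
          then show ?thesis by (intro nn_integral_cong) (auto simp: W_def indicator_def)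
        qed
        finally show ?thesis using True by simp
      qed simp
    qed
    also have "\<dots> \<le> ennreal (3 powr n) * (\<integral>\<^sup>+y. 6 * W y * ennreal (dist x y powr (1 - n)) \<partial>lborel)"
      using nn_integral_cone_le[of "\<lambda>y. 6 * W y" e x] e by (simp add: n_eq)
    also have "(\<integral>\<^sup>+y. 6 * W y * ennreal (dist x y powr (1 - n)) \<partial>lborel)
       = 6 * (\<integral>\<^sup>+y. W y * ennreal (dist x y powr (1 - n)) \<partial>lborel)"
      by (subst nn_integral_cmult[symmetric]) (auto simp: ac_simps)
    finally have "ennreal (2 / \<omega>) * (ennreal b * ennreal (\<omega> / 2))
      \<le> ennreal (2 / \<omega>) * (ennreal (3 powr n) * (6 * (\<integral>\<^sup>+y. W y * ennreal (dist x y powr (1 - n)) \<partial>lborel)))"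
      by (rule mult_left_mono) simp
    moreover have "ennreal (2 / \<omega>) * (ennreal b * ennreal (\<omega> / 2)) = ennreal b"
      using b by (simp flip: ennreal_mult) (simp add: less_imp_neq[OF ball_vol_pos(1), symmetric])
    moreover have "ennreal (2 / \<omega>) * (ennreal (3 powr n) * (6 * Z)) = ennreal (12 * 3 powr n / \<omega>) * Z" for Z
    proof -
      have "ennreal (2 / \<omega>) * (ennreal (3 powr n) * ennreal 6) = ennreal (2 / \<omega>) * ennreal (3 powr n * 6)"
        by (subst ennreal_mult) auto
      also have "\<dots> = ennreal (2 / \<omega> * (3 powr n * 6))" by (rule ennreal_mult[symmetric]) auto
      also have "2 / \<omega> * (3 powr n * 6) = 12 * 3 powr n / \<omega>" by simp
      finally show ?thesis by (simp add: mult.assoc flip: ennreal_numeral) (simp flip: mult.assoc)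
    qed
    ultimately show "ennreal b \<le> ennreal (12 * 3 powr n / \<omega>) * (\<integral>\<^sup>+y. indicator {y. c * \<delta> x \<le> \<delta> y} y * band b y *
          ennreal (dist x y powr (1 - n)) \<partial>lborel)"
      by (simp add: W_def)
  qed
qed

definition weight_measure :: "real \<Rightarrow> 'a measure" where
  "weight_measure a = density lborel (\<lambda>x. indicator {x. 0 < \<delta> x} x * ennreal (\<delta> x powr (a - n)))"

lemma space_weight_measure [simp]: "space (weight_measure a) = UNIV"
  and sets_weight_measure [simp, measurable_cong]: "sets (weight_measure a) = sets borel"
  by (auto simp: weight_measure_def)

lemma below_le_weight_measure:
  "A \<in> sets borel \<Longrightarrow> emeasure (below_measure a c h) A \<le> emeasure (weight_measure a) A"
  unfolding below_measure_def weight_measure_def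
  by (auto simp: emeasure_density indicator_def intro!: nn_integral_mono)

text \<open>
  Two estimates of the potential of the weighted measure on \<open>S\<close>, seen from \<open>y\<close>. Without regard to \<open>S\<close>,
  splitting at radius \<open>\<delta> y\<close> bounds it by a multiple of \<open>\<delta> y powr (a - n + 1)\<close>; this is the case
  \<open>\<tau> = 0\<close>. Splitting at the radius at which the two parts balance, and using only the total mass of \<open>S\<close>
  in the outer part, gives the case \<open>\<tau> = 1\<close>. The geometric mean of both gives the cases between them.
\<close>

lemma riesz_potential_bound:
  assumes a: "a > d" and c: "0 < c" "c \<le> 1" and \<tau>: "0 \<le> \<tau>" "\<tau> \<le> 1"
  obtains C where "C > 0"
    "\<And>y S. 0 < \<delta> y \<Longrightarrow> S \<in> sets borel \<Longrightarrow> 0 < emeasure (weight_measure a) S \<Longrightarrow>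
       emeasure (weight_measure a) S < \<infinity> \<Longrightarrow>
       (\<integral>\<^sup>+x. indicator S x * ennreal (dist x y powr (1 - n)) \<partial>below_measure a c (\<delta> y))
         \<le> ennreal (C * measure (weight_measure a) S powr (\<tau> / n) * \<delta> y powr (a - n + 1 - a * \<tau> / n))"
proof -
  obtain A where A: "A > 0"
    "\<And>y \<rho>. 0 < \<delta> y \<Longrightarrow> 0 < \<rho> \<Longrightarrow>
       emeasure (below_measure a c (\<delta> y)) (cball y \<rho>) \<le> ennreal (A * \<delta> y powr (a - n) * \<rho> powr n)"
    using below_measure_cball_all[OF a c] by blast
  obtain B where B: "B > 0"
    "\<And>y \<rho>. 0 < \<delta> y \<Longrightarrow> \<delta> y \<le> \<rho> \<Longrightarrow>
       emeasure (below_measure a c (\<delta> y)) (cball y \<rho>) \<le> ennreal (B * \<delta> y powr (a - d) * \<rho> powr d)"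
    using below_measure_cball_large[OF a c] by blast
  define A' where "A' = 2 powr \<bar>1 - n\<bar> / (1 - 2 powr (-(n + (1 - n)))) * A"
  define B' where "B' = 2 powr d / (1 - 2 powr (d + (1 - n))) * B"
  have A': "A' > 0" using A by (simp add: A'_def powr_minus)
  have "(2::real) powr (d + (1 - n)) < 1" using d_less powr_less_mono[of "d + (1-n)" 0 "2::real"] by simp
  then have B': "B' > 0" using B by (simp add: B'_def)
  have inner: "(\<integral>\<^sup>+x. indicator {x. 0 < dist x y \<and> dist x y \<le> s} x * ennreal (dist x y powr (1 - n)) \<partial>below_measure a c (\<delta> y))
     \<le> ennreal (A' * \<delta> y powr (a - n) * s)" if "0 < \<delta> y" "0 < s" for y s
  proof -
    let ?M = "below_measure a c (\<delta> y)"
    have "(\<integral>\<^sup>+x. indicator {x\<in>space ?M. 0 < dist x y \<and> dist x y \<le> s} x * ennreal (dist x y powr (1 - n)) \<partial>?M)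
      \<le> ennreal (2 powr \<bar>1 - n\<bar> / (1 - 2 powr (-(n + (1 - n)))) * (A * \<delta> y powr (a - n)) * s powr (n + (1 - n)))"
    proof (rule nn_integral_powr_small)
      fix \<sigma> :: real assume "0 < \<sigma>" "\<sigma> \<le> s"
      have "emeasure ?M {x\<in>space ?M. 0 < dist x y \<and> dist x y \<le> \<sigma>} \<le> emeasure ?M (cball y \<sigma>)"
        by (intro emeasure_mono) (auto simp: dist_commute)
      also have "\<dots> \<le> ennreal (A * \<delta> y powr (a - n) * \<sigma> powr n)"
        using \<open>0 < \<sigma>\<close> \<open>0 < \<delta> y\<close> by (intro A)
      finally show "emeasure ?M {x\<in>space ?M. 0 < dist x y \<and> dist x y \<le> \<sigma>} \<le> \<dots>" .
    qed (use that A in auto)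
    then show ?thesis using \<open>0 < s\<close> by (simp add: A'_def mult.assoc)
  qed
  have outer: "(\<integral>\<^sup>+x. indicator {x. \<delta> y < dist x y} x * ennreal (dist x y powr (1 - n)) \<partial>below_measure a c (\<delta> y))
     \<le> ennreal (B' * \<delta> y powr (a - n + 1))" if "0 < \<delta> y" for y
  proof -
    let ?M = "below_measure a c (\<delta> y)"
    have "(\<integral>\<^sup>+x. indicator {x\<in>space ?M. \<delta> y < dist x y} x * ennreal (dist x y powr (1 - n)) \<partial>?M)
      \<le> ennreal (2 powr d / (1 - 2 powr (d + (1 - n))) * (B * \<delta> y powr (a - d)) * \<delta> y powr (d + (1 - n)))"
    proof (rule nn_integral_powr_large)
      fix \<sigma> :: real assume "\<delta> y \<le> \<sigma>"
      have "emeasure ?M {x\<in>space ?M. dist x y \<le> \<sigma>} = emeasure ?M (cball y \<sigma>)"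
        by (intro arg_cong2[where f=emeasure]) (auto simp: dist_commute)
      also have "\<dots> \<le> ennreal (B * \<delta> y powr (a - d) * \<sigma> powr d)"
        using \<open>\<delta> y \<le> \<sigma>\<close> \<open>0 < \<delta> y\<close> by (intro B)
      finally show "emeasure ?M {x\<in>space ?M. dist x y \<le> \<sigma>} \<le> \<dots>" .
    qed (use that B d_less n_gt_1 in auto)
    also have "2 powr d / (1 - 2 powr (d + (1 - n))) * (B * \<delta> y powr (a - d)) * \<delta> y powr (d + (1 - n))
       = B' * \<delta> y powr (a - n + 1)"
      by (simp add: B'_def algebra_simps flip: powr_add)
    finally show ?thesis by simp
  qed
  define A2 where "A2 = A' + 1"
  define C where "C = (A' + B') powr (1 - \<tau>) * A2 powr \<tau>"
  show ?thesis
  proof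
    show "C > 0" using A' B' by (auto simp: C_def A2_def)
    fix y S assume y: "0 < \<delta> y" and S[measurable]: "S \<in> sets borel"
      and mpos: "0 < emeasure (weight_measure a) S" and mfin: "emeasure (weight_measure a) S < \<infinity>"
    let ?M = "below_measure a c (\<delta> y)"
    let ?p = "a - n + 1"
    define m where "m = measure (weight_measure a) S"
    have em: "emeasure (weight_measure a) S = ennreal m"
      using mfin by (simp add: m_def emeasure_eq_ennreal_measure less_top[symmetric])
    have m: "m > 0" using mpos em by simp
    define T where "T = (\<integral>\<^sup>+x. indicator S x * ennreal (dist x y powr (1 - n)) \<partial>?M)"
    have split: "T \<le> (\<integral>\<^sup>+x. indicator {x. 0 < dist x y \<and> dist x y \<le> s} x * ennreal (dist x y powr (1 - n)) \<partial>?M)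
        + (\<integral>\<^sup>+x. indicator {x. s < dist x y} x * (indicator S x * ennreal (dist x y powr (1 - n))) \<partial>?M)" for s
    proof -
      have "T \<le> (\<integral>\<^sup>+x. indicator {x. 0 < dist x y \<and> dist x y \<le> s} x * ennreal (dist x y powr (1 - n)) 
          + indicator {x. s < dist x y} x * (indicator S x * ennreal (dist x y powr (1 - n))) \<partial>?M)"
        unfolding T_def by (intro nn_integral_mono) (auto simp: indicator_def)
      then show ?thesis by (subst (asm) nn_integral_add) auto
    qed
    have T1: "T \<le> ennreal ((A' + B') * \<delta> y powr ?p)"
    proof -
      have "T \<le> ennreal (A' * \<delta> y powr (a - n) * \<delta> y) + 
         (\<integral>\<^sup>+x. indicator {x. \<delta> y < dist x y} x * (indicator S x * ennreal (dist x y powr (1 - n))) \<partial>?M)"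
        by (rule order_trans[OF split[of "\<delta> y"]]) (intro add_right_mono inner y)
      also have "\<dots> \<le> ennreal (A' * \<delta> y powr (a - n) * \<delta> y) + 
         (\<integral>\<^sup>+x. indicator {x. \<delta> y < dist x y} x * ennreal (dist x y powr (1 - n)) \<partial>?M)"
        by (intro add_left_mono nn_integral_mono) (auto simp: indicator_def)
      also have "\<dots> \<le> ennreal (A' * \<delta> y powr (a - n) * \<delta> y) + ennreal (B' * \<delta> y powr ?p)"
        by (intro add_left_mono outer y)
      also have "\<dots> = ennreal ((A' + B') * \<delta> y powr ?p)"
      proof -
        have *: "A' * \<delta> y powr (a - n) * \<delta> y = A' * \<delta> y powr ?p"
          using y by (simp add: powr_add)
        show ?thesis unfolding * using A' B' by (simp add: distrib_right)
      qed
      finally show ?thesis .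
    qed
    have T2: "T \<le> ennreal (A2 * m powr (1 / n) * \<delta> y powr (?p - a / n))"
    proof -
      \<comment> \<open>With this \<open>r\<close> the inner bound \<open>\<delta> y powr (a - n) * r\<close> equals the outer one \<open>r powr (1 - n) * m\<close>.\<close>
      define r where "r = m powr (1 / n) * \<delta> y powr ((n - a) / n)"
      have r: "r > 0" using m y by (simp add: r_def)
      have "(\<integral>\<^sup>+x. indicator {x. r < dist x y} x * (indicator S x * ennreal (dist x y powr (1 - n))) \<partial>?M)
        \<le> (\<integral>\<^sup>+x. ennreal (r powr (1 - n)) * indicator S x \<partial>?M)"
        using r n_gt_1 by (intro nn_integral_mono) (auto simp: indicator_def intro!: ennreal_leI powr_mono2')
      also have "\<dots> = ennreal (r powr (1 - n)) * emeasure ?M S"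
        by (rule nn_integral_cmult_indicator) simp
      also have "\<dots> \<le> ennreal (r powr (1 - n)) * ennreal m"
        unfolding em[symmetric] by (intro mult_left_mono below_le_weight_measure) auto
      also have "\<dots> = ennreal (r powr (1 - n) * m)" using m by (simp flip: ennreal_mult)
      finally have "T \<le> ennreal (A' * \<delta> y powr (a - n) * r) + ennreal (r powr (1 - n) * m)"
        using inner[OF y r] split[of r] by (meson add_mono order_trans)
      also have "r powr (1 - n) * m = m powr (1 / n) * \<delta> y powr (?p - a / n)"
      proof -
        have "r powr (1 - n) * m = m powr ((1 / n) * (1 - n)) * m powr 1 * \<delta> y powr ((n - a) / n * (1 - n))"
          using m y by (simp add: r_def powr_mult powr_powr)
        also have "\<dots> = m powr ((1 / n) * (1 - n) + 1) * \<delta> y powr ((n - a) / n * (1 - n))"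
          by (simp only: powr_add)
        also have "(1 / n) * (1 - n) + 1 = 1 / n" using n_gt_1 by (simp add: field_simps)
        also have "(n - a) / n * (1 - n) = ?p - a / n" using n_gt_1 by (simp add: field_simps)
        finally show ?thesis .
      qed
      also have "A' * \<delta> y powr (a - n) * r = A' * (m powr (1 / n) * \<delta> y powr (?p - a / n))"
      proof -
        have "\<delta> y powr (a - n) * r = m powr (1 / n) * \<delta> y powr ((a - n) + (n - a) / n)"
          by (simp add: r_def powr_add)
        also have "(a - n) + (n - a) / n = ?p - a / n" using n_gt_1 by (simp add: field_simps)
        finally show ?thesis by simp
      qed
      also have "ennreal (A' * (m powr (1 / n) * \<delta> y powr (?p - a / n))) + ennreal (m powr (1 / n) * \<delta> y powr (?p - a / n))
         = ennreal (A2 * m powr (1 / n) * \<delta> y powr (?p - a / n))"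
        using A' by (simp add: A2_def algebra_simps flip: ennreal_plus)
      finally show ?thesis .
    qed
    define t where "t = enn2real T"
    have "T < top" using T1 ennreal_less_top by (rule le_less_trans)
    then have Tt: "T = ennreal t" by (simp add: t_def)
    have t: "0 \<le> t" "t \<le> (A' + B') * \<delta> y powr ?p" "t \<le> A2 * m powr (1 / n) * \<delta> y powr (?p - a / n)"
    proof -
      show "0 \<le> t" by (simp add: t_def)
      show "t \<le> (A' + B') * \<delta> y powr ?p" using T1 A' B' unfolding Tt by (subst (asm) ennreal_le_iff) auto
      show "t \<le> A2 * m powr (1 / n) * \<delta> y powr (?p - a / n)"
        using T2 A' unfolding Tt by (subst (asm) ennreal_le_iff) (auto simp: A2_def)
    qed
    have "t = t powr (1 - \<tau>) * t powr \<tau>" using t(1) by (simp flip: powr_add)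
    also have "\<dots> \<le> ((A' + B') * \<delta> y powr ?p) powr (1 - \<tau>) * (A2 * m powr (1 / n) * \<delta> y powr (?p - a / n)) powr \<tau>"
      using t \<tau> by (intro mult_mono powr_mono2) auto
    also have "\<dots> = C * m powr (\<tau> / n) * (\<delta> y powr (?p * (1 - \<tau>)) * \<delta> y powr ((?p - a / n) * \<tau>))"
      using A' B' m y by (simp add: C_def powr_mult powr_powr A2_def)
    also have "\<delta> y powr (?p * (1 - \<tau>)) * \<delta> y powr ((?p - a / n) * \<tau>) = \<delta> y powr (?p - a * \<tau> / n)"
      by (simp only: powr_add[symmetric]) (simp add: algebra_simps)
    finally show "T \<le> ennreal (C * m powr (\<tau> / n) * \<delta> y powr (?p - a * \<tau> / n))"
      unfolding Tt by (rule ennreal_leI)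
  qed
qed

end

section \<open>Weak and strong type inequalities\<close>

lemma nn_integral_compact_finite:
  fixes k :: "'a::euclidean_space \<Rightarrow> real"
  assumes "compact X" "continuous_on X k"
  shows "(\<integral>\<^sup>+x. indicator X x * ennreal (k x) \<partial>lborel) < \<infinity>"
proof -
  have "bounded (k ` X)" by (intro compact_imp_bounded compact_continuous_image assms)
  then obtain M where M: "\<And>x. x \<in> X \<Longrightarrow> k x \<le> M"
    by (auto simp: bounded_iff) (metis abs_le_D1)
  have "(\<integral>\<^sup>+x. indicator X x * ennreal (k x) \<partial>lborel) \<le> (\<integral>\<^sup>+x. ennreal M * indicator X x \<partial>lborel)"
    using M by (intro nn_integral_mono) (auto simp: indicator_def intro: ennreal_leI)
  also have "\<dots> = ennreal M * emeasure lborel X"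
    using compact_imp_closed[OF assms(1)] by (intro nn_integral_cmult_indicator) auto
  also have "\<dots> < \<infinity>"
    using emeasure_bounded_finite[OF compact_imp_bounded[OF assms(1)]] by (simp add: ennreal_mult_less_top)
  finally show ?thesis .
qed

text \<open>
  Young's inequality for \<open>u / J powr (1/p)\<close> and \<open>v / I powr (1/p')\<close>, integrated. Upper bounds \<open>I\<close>
  and \<open>J\<close> instead of the integrals themselves keep the right-hand side real.
\<close>

lemma nn_integral_Holder:
  fixes u v :: "'b \<Rightarrow> real" and p p' :: real
  assumes [measurable]: "u \<in> borel_measurable M" "v \<in> borel_measurable M"
    and nonneg: "\<And>x. 0 \<le> u x" "\<And>x. 0 \<le> v x"
    and p: "p > 1" "p' > 1" "1 / p + 1 / p' = 1"
    and J: "(\<integral>\<^sup>+x. ennreal (u x powr p) \<partial>M) \<le> ennreal J" "0 \<le> J"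
    and I: "(\<integral>\<^sup>+x. ennreal (v x powr p') \<partial>M) \<le> ennreal I" "0 < I"
  shows "(\<integral>\<^sup>+x. ennreal (u x * v x) \<partial>M) \<le> ennreal (J powr (1 / p) * I powr (1 / p'))"
proof (cases "J = 0")
  case True
  then have "(\<integral>\<^sup>+x. ennreal (u x powr p) \<partial>M) = 0" using J by simp
  then have "AE x in M. ennreal (u x powr p) = 0" by (subst (asm) nn_integral_0_iff_AE) auto
  then have "AE x in M. ennreal (u x * v x) = 0" by eventually_elim auto
  then have "(\<integral>\<^sup>+x. ennreal (u x * v x) \<partial>M) = 0" by (subst nn_integral_0_iff_AE) auto
  then show ?thesis by simp
next
  case False
  with J have J0: "J > 0" by simp
  let ?c = "J powr (1 / p) * I powr (1 / p')"
  have "u x * v x \<le> ?c / (p * J) * (u x powr p) + ?c / (p' * I) * (v x powr p')" for x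
  proof -
    have "(u x / J powr (1/p)) * (v x / I powr (1/p'))
      \<le> (u x / J powr (1/p)) powr p / p + (v x / I powr (1/p')) powr p' / p'"
      by (rule Youngs_inequality) (use p nonneg in auto)
    also have "\<dots> = u x powr p / (p * J) + v x powr p' / (p' * I)"
      using J0 I p nonneg by (simp add: powr_divide powr_powr field_simps)
    finally have "?c * ((u x / J powr (1/p)) * (v x / I powr (1/p'))) \<le> ?c * (u x powr p / (p * J) + v x powr p' / (p' * I))"
      by (intro mult_left_mono) auto
    moreover have "?c * ((u x / J powr (1/p)) * (v x / I powr (1/p'))) = u x * v x"
      using J0 I by simp
    ultimately show ?thesis by (simp add: distrib_left)
  qed
  then have "(\<integral>\<^sup>+x. ennreal (u x * v x) \<partial>M)
     \<le> (\<integral>\<^sup>+x. ennreal (?c / (p * J)) * ennreal (u x powr p) + ennreal (?c / (p' * I)) * ennreal (v x powr p') \<partial>M)"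
    using J0 I p by (intro nn_integral_mono) (simp add: ennreal_leI flip: ennreal_mult ennreal_plus)
  also have "\<dots> = ennreal (?c / (p * J)) * (\<integral>\<^sup>+x. ennreal (u x powr p) \<partial>M) + ennreal (?c / (p' * I)) * (\<integral>\<^sup>+x. ennreal (v x powr p') \<partial>M)"
    by (simp add: nn_integral_add nn_integral_cmult)
  also have "\<dots> \<le> ennreal (?c / (p * J)) * ennreal J + ennreal (?c / (p' * I)) * ennreal I"
    by (intro add_mono mult_left_mono J I) auto
  also have "\<dots> = ennreal (?c * (1 / p)) + ennreal (?c * (1 / p'))"
    using J0 I p by (simp flip: ennreal_mult)
  also have "\<dots> = ennreal (?c * (1 / p + 1 / p'))"
    unfolding distrib_left by (rule ennreal_plus[symmetric]) (use p in auto)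
  finally show ?thesis using p by simp
qed

context C1_function
begin

lemma gradient_supp: "x \<notin> X \<Longrightarrow> g x = 0"
proof -
  assume x: "x \<notin> X"
  have "((\<lambda>x. 0) has_derivative (\<lambda>v. 0)) (at x)" by simp
  then have "(f has_derivative (\<lambda>v. 0)) (at x)"
    by (rule has_derivative_transform_within_open[where s="- X"])
      (use x supp compact_X in \<open>auto intro: compact_imp_closed simp: open_Compl\<close>)
  then have "(\<lambda>v. g x \<bullet> v) = (\<lambda>v. 0)" by (rule has_derivative_unique[OF deriv])
  then have "g x \<bullet> g x = 0" by metis
  then show "g x = 0" by simp
qed

lemma bounded_f: obtains M where "M > 0" "\<And>x. \<bar>f x\<bar> < M"
proof -
  have "bounded (f ` X)"
    using cont_f by (intro compact_imp_bounded compact_continuous_image compact_X) (auto intro: continuous_on_subset)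
  then obtain M where "\<And>x. x \<in> X \<Longrightarrow> \<bar>f x\<bar> \<le> M" by (auto simp: bounded_iff)
  then have "\<bar>f x\<bar> < \<bar>M\<bar> + 1" for x using supp[of x] by (cases "x \<in> X") fastforce+
  then show ?thesis using that[of "\<bar>M\<bar> + 1"] by auto
qed

text \<open>
  The signed power is a difference of one-sided powers, and its derivative \<open>s * \<bar>v\<bar> powr (s - 1)\<close> carries
  no sign.
\<close>

lemma signed_power:
  assumes s: "s > 1"
  defines "F \<equiv> \<lambda>x. max 0 (f x) powr s - max 0 (- f x) powr s"
    and "H \<equiv> \<lambda>x. (s * \<bar>f x\<bar> powr (s - 1)) *\<^sub>R g x"
  shows "C1_function F H X" and "\<And>x. \<bar>F x\<bar> = \<bar>f x\<bar> powr s"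
proof -
  show "C1_function F H X"
  proof
    fix x
    define v where "v = f x"
    have "((\<lambda>w. max 0 w powr s - max 0 (- w) powr s) has_real_derivative
       s * max 0 v powr (s - 1) - (s * max 0 (- v) powr (s - 1)) * (- 1)) (at v)"
      by (intro DERIV_diff DERIV_chain2[OF has_real_derivative_pos_part_powr[OF s]]
         has_real_derivative_pos_part_powr[OF s] derivative_eq_intros) auto
    also have "s * max 0 v powr (s - 1) - (s * max 0 (- v) powr (s - 1)) * (- 1) = s * \<bar>v\<bar> powr (s - 1)"
      by (auto simp: max_def)
    finally have "((\<lambda>w. max 0 w powr s - max 0 (- w) powr s) has_derivative (\<lambda>h. h * (s * \<bar>v\<bar> powr (s - 1)))) (at (f x))"
      by (simp add: has_field_derivative_def mult_commute_abs v_def)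
    from has_derivative_compose[OF deriv this]
    show "(F has_derivative (\<lambda>h. H x \<bullet> h)) (at x)"
      by (simp add: F_def H_def v_def mult.commute)
  next
    show "continuous_on UNIV H" unfolding H_def
      by (intro continuous_intros cont_f cont_g continuous_on_powr') (use s in auto)
  qed (auto simp: F_def supp compact_X)
  show "\<bar>F x\<bar> = \<bar>f x\<bar> powr s" for x by (auto simp: F_def max_def)
qed

end

context thin_set
begin

lemma continuous_on_dist_powr: "X \<inter> E = {} \<Longrightarrow> continuous_on X (\<lambda>x. \<delta> x powr k)"
  using dist_pos_iff by (intro continuous_intros) (auto simp: less_le)

lemma emeasure_weight_measure_compact:
  assumes "compact X" "X \<inter> E = {}"
  shows "emeasure (weight_measure a) X < \<infinity>"
proof -
  have [measurable]: "X \<in> sets borel" using compact_imp_closed[OF assms(1)] by simp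
  have "emeasure (weight_measure a) X
     = (\<integral>\<^sup>+x. indicator {x. 0 < \<delta> x} x * ennreal (\<delta> x powr (a - n)) * indicator X x \<partial>lborel)"
    unfolding weight_measure_def by (rule emeasure_density) measurable
  also have "\<dots> = (\<integral>\<^sup>+x. indicator X x * ennreal (\<delta> x powr (a - n)) \<partial>lborel)"
    using assms dist_pos_iff by (intro nn_integral_cong) (auto simp: indicator_def)
  finally have "emeasure (weight_measure a) X = (\<integral>\<^sup>+x. indicator X x * ennreal (\<delta> x powr (a - n)) \<partial>lborel)" .
  then show ?thesis using nn_integral_compact_finite[OF assms(1) continuous_on_dist_powr[OF assms(2)]] by simp
qed

text \<open>
  Integrate \<open>pointwise_bound\<close> over the superlevel set \<open>S\<close> and exchange the integrals; the inner one is
  then the potential bounded in \<open>riesz_potential_bound\<close>. Cancelling \<open>m powr (\<tau> / n)\<close>, where \<open>m\<close> is the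
  measure of \<open>S\<close>, leaves the claim.
\<close>

lemma weak_type_bound:
  assumes a: "a > d" and \<tau>: "0 \<le> \<tau>" "\<tau> \<le> 1"
  obtains C where "C > 0"
    "\<And>f g X b. C1_function f g X \<Longrightarrow> X \<inter> E = {} \<Longrightarrow> b > 0 \<Longrightarrow>
       ennreal (b * measure (weight_measure a) {x. 2 * b \<le> \<bar>f x\<bar>} powr (1 - \<tau> / n))
       \<le> ennreal C * (\<integral>\<^sup>+y. C1_function.band f g b y * ennreal (\<delta> y powr (a - n + 1 - a * \<tau> / n)) \<partial>lborel)"
proof -
  obtain c C where c: "0 < c" "c \<le> 1" and C: "0 < C"
    "\<And>f g X b x. C1_function f g X \<Longrightarrow> X \<inter> E = {} \<Longrightarrow> b > 0 \<Longrightarrow> 2 * b \<le> \<bar>f x\<bar> \<Longrightarrow>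
       ennreal b \<le> ennreal C * (\<integral>\<^sup>+y. indicator {y. c * \<delta> x \<le> \<delta> y} y * C1_function.band f g b y *
          ennreal (dist x y powr (1 - n)) \<partial>lborel)"
    using pointwise_bound by blast
  obtain D where D: "D > 0"
    "\<And>y S. 0 < \<delta> y \<Longrightarrow> S \<in> sets borel \<Longrightarrow> 0 < emeasure (weight_measure a) S \<Longrightarrow>
       emeasure (weight_measure a) S < \<infinity> \<Longrightarrow>
       (\<integral>\<^sup>+x. indicator S x * ennreal (dist x y powr (1 - n)) \<partial>below_measure a c (\<delta> y))
         \<le> ennreal (D * measure (weight_measure a) S powr (\<tau> / n) * \<delta> y powr (a - n + 1 - a * \<tau> / n))"
    using riesz_potential_bound[OF a c \<tau>] by blast
  show ?thesis
  proof
    show "C * D > 0" using C D by simp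
    fix f :: "'a \<Rightarrow> real" and g X and b :: real
    assume C1: "C1_function f g X" and XE: "X \<inter> E = {}" and b: "b > 0"
    interpret C1_function f g X by (rule C1)
    let ?\<mu> = "weight_measure a"
    let ?\<gamma> = "a - n + 1 - a * \<tau> / n"
    define S where "S = {x. 2 * b \<le> \<bar>f x\<bar>}"
    define m where "m = measure ?\<mu> S"
    have S [measurable]: "S \<in> sets borel" unfolding S_def by measurable
    have "S \<subseteq> X" using supp b by (force simp: S_def)
    then have "emeasure ?\<mu> S \<le> emeasure ?\<mu> X"
      using compact_imp_closed[OF compact_X] by (intro emeasure_mono) auto
    then have fin: "emeasure ?\<mu> S < \<infinity>"
      using emeasure_weight_measure_compact[OF compact_X XE] by (rule le_less_trans)
    then have em: "emeasure ?\<mu> S = ennreal m"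
      by (simp add: m_def emeasure_eq_ennreal_measure less_top[symmetric])
    define w where "w x = (indicator {x. 0 < \<delta> x} x * ennreal (\<delta> x powr (a - n)) :: ennreal)" for x
    have [measurable]: "w \<in> borel_measurable borel" unfolding w_def by measurable
    let ?k = "\<lambda>x y. indicator {p. c * \<delta> (fst p) \<le> \<delta> (snd p)} (x, y) * band b y * ennreal (dist x y powr (1 - n))"
    have [measurable]: "{p. c * \<delta> (fst p) \<le> \<delta> (snd p)} \<in> sets (borel \<Otimes>\<^sub>M borel)"
      unfolding borel_prod by (intro borel_closed closed_Collect_le continuous_intros)
    show "ennreal (b * measure ?\<mu> {x. 2 * b \<le> \<bar>f x\<bar>} powr (1 - \<tau> / n))
       \<le> ennreal (C * D) * (\<integral>\<^sup>+y. band b y * ennreal (\<delta> y powr ?\<gamma>) \<partial>lborel)"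
    proof (cases "m = 0")
      case True
      then show ?thesis by (simp add: m_def S_def)
    next
      case False
      then have m: "m > 0" by (simp add: m_def less_le)
      have "ennreal b * ennreal m = (\<integral>\<^sup>+x. ennreal b * indicator S x \<partial>?\<mu>)"
        unfolding em[symmetric] by (subst nn_integral_cmult_indicator) auto
      also have "\<dots> = (\<integral>\<^sup>+x. w x * (ennreal b * indicator S x) \<partial>lborel)"
        unfolding weight_measure_def w_def by (subst nn_integral_density) auto
      also have "\<dots> \<le> (\<integral>\<^sup>+x. ennreal C * (\<integral>\<^sup>+y. w x * indicator S x * ?k x y \<partial>lborel) \<partial>lborel)"
      proof (rule nn_integral_mono)
        fix x
        show "w x * (ennreal b * indicator S x) \<le> ennreal C * (\<integral>\<^sup>+y. w x * indicator S x * ?k x y \<partial>lborel)"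
        proof (cases "x \<in> S")
          case True
          have "ennreal b \<le> ennreal C * (\<integral>\<^sup>+y. ?k x y \<partial>lborel)"
            using C(2)[OF C1 XE b, of x] True by (simp add: S_def indicator_def)
          then have "w x * ennreal b \<le> w x * (ennreal C * (\<integral>\<^sup>+y. ?k x y \<partial>lborel))"
            by (rule mult_left_mono) simp
          also have "\<dots> = ennreal C * (\<integral>\<^sup>+y. w x * ?k x y \<partial>lborel)"
            by (subst nn_integral_cmult) (auto simp: ac_simps)
          finally show ?thesis using True by simp
        qed simp
      qed
      also have "\<dots> = ennreal C * (\<integral>\<^sup>+x. (\<integral>\<^sup>+y. w x * indicator S x * ?k x y \<partial>lborel) \<partial>lborel)"
        by (rule nn_integral_cmult) measurable
      also have "(\<integral>\<^sup>+x. (\<integral>\<^sup>+y. w x * indicator S x * ?k x y \<partial>lborel) \<partial>lborel)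
        = (\<integral>\<^sup>+y. (\<integral>\<^sup>+x. w x * indicator S x * ?k x y \<partial>lborel) \<partial>lborel)"
        by (rule lborel_pair.Fubini'[symmetric]) measurable
      also have "\<dots> \<le> (\<integral>\<^sup>+y. ennreal (D * m powr (\<tau> / n)) * (band b y * ennreal (\<delta> y powr ?\<gamma>)) \<partial>lborel)"
      proof (rule nn_integral_mono)
        fix y
        show "(\<integral>\<^sup>+x. w x * indicator S x * ?k x y \<partial>lborel) \<le> ennreal (D * m powr (\<tau> / n)) * (band b y * ennreal (\<delta> y powr ?\<gamma>))"
        proof (cases "band b y = 0")
          case False
          then have "f y \<noteq> 0" using b by (auto simp: band_def indicator_def split: if_splits)
          then have y: "0 < \<delta> y" using supp XE dist_pos_iff by blast
          have "(\<integral>\<^sup>+x. w x * indicator S x * ?k x y \<partial>lborel)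
             = (\<integral>\<^sup>+x. band b y * (indicator {x. 0 < \<delta> x \<and> c * \<delta> x \<le> \<delta> y} x * ennreal (\<delta> x powr (a - n))
                   * (indicator S x * ennreal (dist x y powr (1 - n)))) \<partial>lborel)"
            by (intro nn_integral_cong) (auto simp: w_def indicator_def ac_simps)
          also have "\<dots> = band b y * (\<integral>\<^sup>+x. indicator S x * ennreal (dist x y powr (1 - n)) \<partial>below_measure a c (\<delta> y))"
            unfolding below_measure_def by (subst nn_integral_cmult, measurable) (subst nn_integral_density, auto)
          also have "\<dots> \<le> band b y * ennreal (D * m powr (\<tau> / n) * \<delta> y powr ?\<gamma>)"
            unfolding m_def by (intro mult_left_mono D y S fin) (use em m in auto)
          also have "\<dots> = ennreal (D * m powr (\<tau> / n)) * (band b y * ennreal (\<delta> y powr ?\<gamma>))"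
            using D by (simp add: ennreal_mult ac_simps)
          finally show ?thesis .
        qed simp
      qed
      also have "\<dots> = ennreal (D * m powr (\<tau> / n)) * (\<integral>\<^sup>+y. band b y * ennreal (\<delta> y powr ?\<gamma>) \<partial>lborel)"
        by (rule nn_integral_cmult) measurable
      finally have "ennreal b * ennreal m \<le> ennreal C * (ennreal (D * m powr (\<tau> / n)) * (\<integral>\<^sup>+y. band b y * ennreal (\<delta> y powr ?\<gamma>) \<partial>lborel))"
        by (meson mult_left_mono zero_le)
      then have "ennreal (m powr (- \<tau> / n)) * (ennreal b * ennreal m)
        \<le> ennreal (m powr (- \<tau> / n)) * (ennreal C * (ennreal (D * m powr (\<tau> / n)) * (\<integral>\<^sup>+y. band b y * ennreal (\<delta> y powr ?\<gamma>) \<partial>lborel)))"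
        by (rule mult_left_mono) simp
      moreover have "ennreal (m powr (- \<tau> / n)) * (ennreal b * ennreal m) = ennreal (b * m powr (1 - \<tau> / n))"
        using b m by (simp add: powr_diff powr_minus divide_inverse flip: ennreal_mult)
      moreover have "ennreal (m powr (- \<tau> / n)) * (ennreal C * (ennreal (D * m powr (\<tau> / n)) * Z)) = ennreal (C * D) * Z" for Z
      proof -
        have "m powr (- \<tau> / n) * (C * (D * m powr (\<tau> / n))) = C * D"
          using m by (simp add: powr_minus)
        then have "ennreal (m powr (- \<tau> / n)) * (ennreal C * ennreal (D * m powr (\<tau> / n))) = ennreal (C * D)"
          using C D by (simp flip: ennreal_mult)
        then show ?thesis by (simp flip: mult.assoc)
      qed
      ultimately show ?thesis by (simp add: m_def S_def)
    qed
  qed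
qed

end

context thin_set
begin

text \<open>
  The bands between \<open>b\<close> and \<open>2 * b\<close> are disjoint for different dyadic \<open>b\<close>, so the weak type inequalities
  share the integral of the gradient among themselves. They are summable because \<open>Q \<ge> 1\<close>: the sum of
  the powers \<open>I j powr Q\<close> is at most \<open>J powr (Q - 1)\<close> times the sum of the \<open>I j\<close>.
\<close>

lemma strong_type_bound:
  assumes a: "a > d" and Q: "1 \<le> Q" "(1 - 1 / Q) * n \<le> 1"
  obtains C where "C > 0"
    "\<And>f g X J. C1_function f g X \<Longrightarrow> X \<inter> E = {} \<Longrightarrow> 0 \<le> J \<Longrightarrow>
       (\<integral>\<^sup>+y. ennreal (norm (g y) * \<delta> y powr (a / Q - n + 1)) \<partial>lborel) \<le> ennreal J \<Longrightarrow>
       (\<integral>\<^sup>+x. ennreal (\<bar>f x\<bar> powr Q) \<partial>weight_measure a) \<le> ennreal (C * J powr Q)"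
proof -
  define \<tau> where "\<tau> = (1 - 1 / Q) * n"
  have \<tau>: "0 \<le> \<tau>" "\<tau> \<le> 1" using Q n_gt_1 by (auto simp: \<tau>_def)
  have \<tau>n: "1 - \<tau> / n = 1 / Q" using n_gt_1 by (simp add: \<tau>_def)
  have "a * \<tau> / n = a * (1 - 1 / Q)" using n_gt_1 by (simp add: \<tau>_def)
  then have \<gamma>: "a - n + 1 - a * \<tau> / n = a / Q - n + 1" by (simp add: algebra_simps)
  obtain C where C: "C > 0"
    "\<And>f g X b. C1_function f g X \<Longrightarrow> X \<inter> E = {} \<Longrightarrow> b > 0 \<Longrightarrow>
       ennreal (b * measure (weight_measure a) {x. 2 * b \<le> \<bar>f x\<bar>} powr (1 / Q))
       \<le> ennreal C * (\<integral>\<^sup>+y. C1_function.band f g b y * ennreal (\<delta> y powr (a / Q - n + 1)) \<partial>lborel)"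
    using weak_type_bound[OF a \<tau>, unfolded \<tau>n \<gamma>] by blast
  show ?thesis
  proof
    show "(4 * C) powr Q > 0" using C by simp
    fix f :: "'a \<Rightarrow> real" and g X J
    assume C1: "C1_function f g X" and XE: "X \<inter> E = {}" and J: "0 \<le> J"
      "(\<integral>\<^sup>+y. ennreal (norm (g y) * \<delta> y powr (a / Q - n + 1)) \<partial>lborel) \<le> ennreal J"
    interpret C1_function f g X by (rule C1)
    let ?\<mu> = "weight_measure a"
    let ?\<gamma> = "a / Q - n + 1"
    obtain M where M: "M > 0" "\<And>x. \<bar>f x\<bar> < M" by (rule bounded_f) blast
    \<comment> \<open>Off its zeros \<open>\<bar>f\<bar>\<close> lies between \<open>2 * b j\<close> and \<open>4 * b j\<close> for some \<open>j\<close>.\<close>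
    define b where "b j = M / 2 ^ (j + 2)" for j :: nat
    have b: "b j > 0" for j using M by (simp add: b_def)
    define S where "S j = {x. 2 * b j \<le> \<bar>f x\<bar>}" for j
    define m where "m j = measure ?\<mu> (S j)" for j
    have S [measurable]: "S j \<in> sets borel" for j unfolding S_def by measurable
    have em: "emeasure ?\<mu> (S j) = ennreal (m j)" for j
    proof -
      have "S j \<subseteq> X" using supp b[of j] by (force simp: S_def)
      then have "emeasure ?\<mu> (S j) \<le> emeasure ?\<mu> X"
        using compact_imp_closed[OF compact_X] by (intro emeasure_mono) auto
      then have "emeasure ?\<mu> (S j) < \<infinity>"
        using emeasure_weight_measure_compact[OF compact_X XE] by (rule le_less_trans)
      then show ?thesis by (simp add: m_def emeasure_eq_ennreal_measure less_top[symmetric])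
    qed
    define I where "I j = (\<integral>\<^sup>+y. band (b j) y * ennreal (\<delta> y powr ?\<gamma>) \<partial>lborel)" for j
    have dyadic: "\<exists>j. 2 * b j \<le> \<bar>f x\<bar> \<and> \<bar>f x\<bar> \<le> 4 * b j" if "f x \<noteq> 0" for x
    proof -
      obtain j0 where "M / \<bar>f x\<bar> < 2 ^ j0" using real_arch_pow[of 2 "M / \<bar>f x\<bar>"] by auto
      then have ex: "M / 2 ^ j0 \<le> \<bar>f x\<bar>" using that by (simp add: field_simps)
      define i where "i = (LEAST j. M / 2 ^ j \<le> \<bar>f x\<bar>)"
      have i: "M / 2 ^ i \<le> \<bar>f x\<bar>" unfolding i_def by (rule LeastI[of _ j0]) (rule ex)
      have "i \<noteq> 0"
      proof
        assume "i = 0"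
        with i M(2)[of x] show False by simp
      qed
      then obtain j where j: "i = Suc j" by (cases i) auto
      have "\<bar>f x\<bar> \<le> M / 2 ^ j" using not_less_Least[of j "\<lambda>j. M / 2 ^ j \<le> \<bar>f x\<bar>"] j by (simp add: i_def)
      with i j show ?thesis by (intro exI[of _ j]) (simp add: b_def field_simps)
    qed
    have "(\<integral>\<^sup>+x. ennreal (\<bar>f x\<bar> powr Q) \<partial>?\<mu>)
      \<le> (\<integral>\<^sup>+x. (\<Sum>j. ennreal ((4 * b j) powr Q) * indicator (S j) x) \<partial>?\<mu>)"
    proof (rule nn_integral_mono)
      fix x
      show "ennreal (\<bar>f x\<bar> powr Q) \<le> (\<Sum>j. ennreal ((4 * b j) powr Q) * indicator (S j) x)"
      proof (cases "f x = 0")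
        case False
        then obtain j where j: "2 * b j \<le> \<bar>f x\<bar>" "\<bar>f x\<bar> \<le> 4 * b j" using dyadic by blast
        have "ennreal (\<bar>f x\<bar> powr Q) \<le> ennreal ((4 * b j) powr Q) * indicator (S j) x"
          using j Q by (auto simp: S_def intro!: ennreal_leI powr_mono2)
        also have "\<dots> \<le> (\<Sum>j. ennreal ((4 * b j) powr Q) * indicator (S j) x)"
          by (rule term_le_suminf_ennreal)
        finally show ?thesis .
      qed simp
    qed
    also have "\<dots> = (\<Sum>j. ennreal ((4 * b j) powr Q * m j))"
      by (subst nn_integral_suminf)
        (auto simp: nn_integral_cmult_indicator em m_def ennreal_mult)
    also have "\<dots> \<le> (\<Sum>j. ennreal ((4 * C) powr Q * J powr (Q - 1)) * I j)"
    proof (intro suminf_le allI)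
      fix j
      have "I j \<le> (\<integral>\<^sup>+y. ennreal (norm (g y) * \<delta> y powr ?\<gamma>) \<partial>lborel)"
        unfolding I_def band_def
        by (intro nn_integral_mono) (auto simp: indicator_def ennreal_mult)
      also note J(2)
      finally have IJ: "I j \<le> ennreal J" .
      define i where "i = enn2real (I j)"
      have Ii: "I j = ennreal i" unfolding i_def using le_less_trans[OF IJ ennreal_less_top] by simp
      have i: "0 \<le> i" "i \<le> J" using IJ J(1) by (auto simp: Ii) (simp add: i_def)
      have "ennreal (b j * m j powr (1 / Q)) \<le> ennreal C * I j"
        unfolding m_def S_def I_def by (rule C(2)[OF C1 XE b])
      then have "b j * m j powr (1 / Q) \<le> C * i"
        using C i by (simp add: Ii flip: ennreal_mult)
      then have "(4 * (b j * m j powr (1 / Q))) powr Q \<le> (4 * (C * i)) powr Q"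
        using b[of j] Q by (intro powr_mono2 mult_left_mono) (auto simp: m_def)
      moreover have "(4 * (b j * m j powr (1 / Q))) powr Q = (4 * b j) powr Q * m j"
        using Q b[of j] by (simp add: powr_mult powr_powr m_def)
      moreover have "(4 * (C * i)) powr Q = (4 * C) powr Q * (i powr (Q - 1) * i)"
      proof -
        have "i powr Q = i powr (Q - 1) * i"
          using i by (cases "i = 0") (auto simp: powr_diff)
        then show ?thesis using C i by (simp add: powr_mult)
      qed
      moreover have "i powr (Q - 1) * i \<le> J powr (Q - 1) * i"
        using i Q by (intro mult_right_mono powr_mono2) auto
      then have "(4 * C) powr Q * (i powr (Q - 1) * i) \<le> (4 * C) powr Q * (J powr (Q - 1) * i)"
        by (intro mult_left_mono) auto
      ultimately have "(4 * b j) powr Q * m j \<le> (4 * C) powr Q * J powr (Q - 1) * i" by (simp add: mult.assoc)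
      then show "ennreal ((4 * b j) powr Q * m j) \<le> ennreal ((4 * C) powr Q * J powr (Q - 1)) * I j"
        using i by (simp add: Ii ennreal_leI flip: ennreal_mult)
    qed auto
    also have "\<dots> = ennreal ((4 * C) powr Q * J powr (Q - 1)) * (\<Sum>j. I j)" by simp
    also have "(\<Sum>j. I j) \<le> ennreal J"
    proof -
      let ?A = "\<lambda>j. {y. b j < \<bar>f y\<bar> \<and> \<bar>f y\<bar> < 2 * b j}"
      have half: "2 * b j \<le> b i" if "i < j" for i j
      proof -
        have "(2::real) ^ Suc i \<le> 2 ^ j" using that by (intro power_increasing) auto
        then have "M / 2 ^ j \<le> M / 2 ^ Suc i" using M by (intro divide_left_mono) auto
        then show ?thesis by (simp add: b_def field_simps)
      qed
      have less: "?A i \<inter> ?A j = {}" if "i < j" for i j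
      proof -
        have False if "b i < \<bar>f y\<bar>" "\<bar>f y\<bar> < 2 * b j" for y
          using half[OF \<open>i < j\<close>] that by linarith
        then show ?thesis by blast
      qed
      have "?A i \<inter> ?A j = {}" if "i \<noteq> j" for i j
        using that less[of i j] less[of j i] by (metis Int_commute nat_neq_iff)
      then have disj: "disjoint_family ?A"
        unfolding disjoint_family_on_def by blast
      have "(\<Sum>j. I j) = (\<integral>\<^sup>+y. (\<Sum>j. band (b j) y * ennreal (\<delta> y powr ?\<gamma>)) \<partial>lborel)"
        unfolding I_def by (rule nn_integral_suminf[symmetric]) measurable
      also have "\<dots> \<le> (\<integral>\<^sup>+y. ennreal (norm (g y) * \<delta> y powr ?\<gamma>) \<partial>lborel)"
      proof (rule nn_integral_mono)
        fix y
        have "(\<Sum>j. band (b j) y * ennreal (\<delta> y powr ?\<gamma>)) = (\<Sum>j. indicator (?A j) y) * (ennreal (norm (g y)) * ennreal (\<delta> y powr ?\<gamma>))"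
          unfolding band_def mult.assoc by simp
        also have "(\<Sum>j. indicator (?A j) y :: ennreal) = indicator (\<Union>j. ?A j) y"
          by (rule suminf_indicator[OF disj])
        also have "indicator (\<Union>j. ?A j) y * (ennreal (norm (g y)) * ennreal (\<delta> y powr ?\<gamma>)) \<le> ennreal (norm (g y) * \<delta> y powr ?\<gamma>)"
          by (auto simp: indicator_def ennreal_mult)
        finally show "(\<Sum>j. band (b j) y * ennreal (\<delta> y powr ?\<gamma>)) \<le> ennreal (norm (g y) * \<delta> y powr ?\<gamma>)" .
      qed
      also note J(2)
      finally show ?thesis .
    qed
    also have "ennreal ((4 * C) powr Q * J powr (Q - 1)) * ennreal J = ennreal ((4 * C) powr Q * J powr Q)"
    proof -
      have "J powr (Q - 1) * J = J powr Q" using J(1) by (cases "J = 0") (auto simp: powr_diff)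
      then show ?thesis using J(1) by (simp add: mult.assoc flip: ennreal_mult)
    qed
    finally show "(\<integral>\<^sup>+x. ennreal (\<bar>f x\<bar> powr Q) \<partial>?\<mu>) \<le> ennreal ((4 * C) powr Q * J powr Q)"
      by (simp add: mult_left_mono)
  qed
qed

lemma nn_integral_weight_measure:
  assumes "C1_function f g X" "X \<inter> E = {}"
  shows "(\<integral>\<^sup>+x. ennreal (\<bar>f x\<bar> powr Q) \<partial>weight_measure a)
    = (\<integral>\<^sup>+x. ennreal (\<bar>f x\<bar> powr Q * \<delta> x powr (a - n)) \<partial>lborel)"
proof -
  interpret C1_function f g X by fact
  have "f x = 0" if "\<not> 0 < \<delta> x" for x using that supp assms(2) dist_pos_iff by blast
  then show ?thesis unfolding weight_measure_def
    by (subst nn_integral_density) (auto simp: indicator_def ennreal_mult ac_simps intro!: nn_integral_cong)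
qed

lemma nn_integral_powr_dist_finite:
  assumes "continuous_on UNIV u" "\<And>x. 0 \<le> u x" "\<And>x. x \<notin> X \<Longrightarrow> u x = 0" "compact X" "X \<inter> E = {}" "p > 0"
  shows "(\<integral>\<^sup>+x. ennreal (u x powr p * \<delta> x powr k) \<partial>lborel) < \<infinity>"
proof -
  have "(\<integral>\<^sup>+x. ennreal (u x powr p * \<delta> x powr k) \<partial>lborel)
     = (\<integral>\<^sup>+x. indicator X x * ennreal (u x powr p * \<delta> x powr k) \<partial>lborel)"
    using assms(3) by (intro nn_integral_cong) (auto simp: indicator_def)
  also have "\<dots> < \<infinity>"
    using assms
    by (intro nn_integral_compact_finite continuous_on_mult continuous_on_dist_powr continuous_on_powr' continuous_intros)
      (auto intro: continuous_on_subset)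
  finally show ?thesis .
qed

section \<open>From the exponent one to the general case\<close>

text \<open>
  The exponents \<open>s\<close> and \<open>\<gamma>\<close> are such that the second factor in Hoelder's inequality,
  \<open>\<bar>f\<bar> powr (s - 1) * \<delta> powr (\<gamma> - \<beta> / p)\<close>, has the integrand \<open>\<bar>f\<bar> powr q * \<delta> powr (a - n)\<close> of the left-hand
  side of the Hardy--Sobolev inequality as its power with the conjugate exponent \<open>p / (p - 1)\<close>.
\<close>

lemma gradient_Holder:
  assumes p: "p > 1" and q: "p \<le> q" and C1: "C1_function f g X" and XE: "X \<inter> E = {}"
    and s: "s = 1 + q * (p - 1) / p" and \<gamma>: "\<gamma> = \<beta> / p + (a - n) * (p - 1) / p"
    and J: "(\<integral>\<^sup>+x. ennreal (norm (g x) powr p * \<delta> x powr \<beta>) \<partial>lborel) \<le> ennreal J" "0 \<le> J"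
    and I: "(\<integral>\<^sup>+x. ennreal (\<bar>f x\<bar> powr q * \<delta> x powr (a - n)) \<partial>lborel) \<le> ennreal I" "0 < I"
  shows "(\<integral>\<^sup>+x. ennreal (norm ((s * \<bar>f x\<bar> powr (s - 1)) *\<^sub>R g x) * \<delta> x powr \<gamma>) \<partial>lborel)
     \<le> ennreal (s * (J powr (1 / p) * I powr (1 - 1 / p)))"
proof -
  interpret C1_function f g X by (rule C1)
  define p' where "p' = p / (p - 1)"
  have p': "p' > 1" "1 / p + 1 / p' = 1" "1 / p' = 1 - 1 / p" using p by (auto simp: p'_def field_simps)
  have s1: "s > 1" using p q by (simp add: s)
  let ?u = "\<lambda>x. norm (g x) * \<delta> x powr (\<beta> / p)"
  let ?v = "\<lambda>x. \<bar>f x\<bar> powr (s - 1) * \<delta> x powr ((a - n) * (p - 1) / p)"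
  have "(\<integral>\<^sup>+x. ennreal (?u x * ?v x) \<partial>lborel) \<le> ennreal (J powr (1 / p) * I powr (1 / p'))"
  proof (rule nn_integral_Holder)
    have "?u x powr p = norm (g x) powr p * \<delta> x powr \<beta>" for x
      using p by (simp add: powr_mult powr_powr)
    then show "(\<integral>\<^sup>+x. ennreal (?u x powr p) \<partial>lborel) \<le> ennreal J" using J by simp
    have "?v x powr p' = \<bar>f x\<bar> powr q * \<delta> x powr (a - n)" for x
    proof -
      have "(s - 1) * p' = q" "(a - n) * (p - 1) / p * p' = a - n" using p by (auto simp: s p'_def)
      then show ?thesis by (simp add: powr_mult powr_powr)
    qed
    then show "(\<integral>\<^sup>+x. ennreal (?v x powr p') \<partial>lborel) \<le> ennreal I" using I by simp
  qed (use p p' I J in auto)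
  then have "ennreal s * (\<integral>\<^sup>+x. ennreal (?u x * ?v x) \<partial>lborel) \<le> ennreal s * ennreal (J powr (1 / p) * I powr (1 - 1 / p))"
    unfolding p'(3) by (rule mult_left_mono) simp
  moreover have "(\<integral>\<^sup>+x. ennreal (norm ((s * \<bar>f x\<bar> powr (s - 1)) *\<^sub>R g x) * \<delta> x powr \<gamma>) \<partial>lborel)
     = (\<integral>\<^sup>+x. ennreal s * ennreal (?u x * ?v x) \<partial>lborel)"
  proof (rule nn_integral_cong)
    fix x
    have *: "norm ((s * \<bar>f x\<bar> powr (s - 1)) *\<^sub>R g x) * \<delta> x powr \<gamma> = s * (?u x * ?v x)"
      using s1 by (simp add: \<gamma> powr_add abs_mult ac_simps)
    show "ennreal (norm ((s * \<bar>f x\<bar> powr (s - 1)) *\<^sub>R g x) * \<delta> x powr \<gamma>) = ennreal s * ennreal (?u x * ?v x)"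
      unfolding * using s1 by (intro ennreal_mult) auto
  qed
  moreover have "\<dots> = ennreal s * (\<integral>\<^sup>+x. ennreal (?u x * ?v x) \<partial>lborel)"
    by (rule nn_integral_cmult) measurable
  ultimately show ?thesis using s1 by (simp add: ennreal_mult)
qed

text \<open>
  The strong type inequality with exponent \<open>Q = q / s\<close> for the signed power of \<open>f\<close> bounds \<open>I powr (1 / Q)\<close>
  by a multiple of \<open>J powr (1 / p) * I powr (1 - 1 / p)\<close>, and \<open>1 / Q = 1 / q + (1 - 1 / p)\<close>. The powers
  of \<open>I\<close> cancel since \<open>I\<close> is finite. The hypothesis \<open>p \<le> q\<close> amounts to \<open>1 \<le> Q\<close>, and \<open>q \<le> n p / (n - p)\<close>
  to \<open>Q \<le> n / (n - 1)\<close>. For \<open>p = 1\<close> one has \<open>s = 1\<close>, and \<open>f\<close> itself is used.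
\<close>

lemma hardy_sobolev_C1:
  fixes p q \<beta> :: real
  defines "a \<equiv> q / p * (n - p + \<beta>)"
  assumes p: "1 \<le> p" "p \<le> q" "p < n" "q \<le> n * p / (n - p)" and a: "d < a"
  obtains C where "C > 0"
    "\<And>f g X. C1_function f g X \<Longrightarrow> X \<inter> E = {} \<Longrightarrow>
      enn2real (\<integral>\<^sup>+x. ennreal (\<bar>f x\<bar> powr q * \<delta> x powr (a - n)) \<partial>lborel) powr (1 / q)
      \<le> C * enn2real (\<integral>\<^sup>+x. ennreal (norm (g x) powr p * \<delta> x powr \<beta>) \<partial>lborel) powr (1 / p)"
proof -
  define s where "s = 1 + q * (p - 1) / p"
  have s: "s \<ge> 1" using p by (simp add: s_def)
  define Q where "Q = q / s"
  have sQ: "s * Q = q" using s by (simp add: Q_def)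
  have invQ: "1 / Q = 1 / q + (1 - 1 / p)" using p s by (simp add: Q_def s_def field_simps)
  have Q1: "1 \<le> Q"
  proof -
    have "1 / q \<le> 1 / p" using p by (intro divide_left_mono) auto
    then have "1 / Q \<le> 1" unfolding invQ by simp
    moreover have "Q > 0" using p s by (simp add: Q_def)
    ultimately show ?thesis by (simp add: field_simps)
  qed
  have Qn: "(1 - 1 / Q) * n \<le> 1"
  proof -
    have "q * (n - p) \<le> n * p" using p by (simp add: field_simps)
    then have "n / p - n / q \<le> 1" using p by (simp add: field_simps)
    then show ?thesis unfolding invQ by (simp add: algebra_simps)
  qed
  have \<gamma>: "a / Q - n + 1 = \<beta> / p + (a - n) * (p - 1) / p"
  proof -
    have "a / Q = a * (1 / q + (1 - 1 / p))" unfolding invQ[symmetric] by simp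
    also have "\<dots> = a / q + a - a / p" by (simp add: algebra_simps)
    also have "a / q = (n - p + \<beta>) / p" using p by (simp add: a_def)
    also have "(n - p + \<beta>) / p = n / p - 1 + \<beta> / p" using p by (simp add: field_simps)
    moreover have "(a - n) * (p - 1) / p = a - n - a / p + n / p" using p by (simp add: field_simps)
    ultimately show ?thesis by simp
  qed
  obtain C where C: "C > 0"
    "\<And>f g X J. C1_function f g X \<Longrightarrow> X \<inter> E = {} \<Longrightarrow> 0 \<le> J \<Longrightarrow>
       (\<integral>\<^sup>+y. ennreal (norm (g y) * \<delta> y powr (a / Q - n + 1)) \<partial>lborel) \<le> ennreal J \<Longrightarrow>
       (\<integral>\<^sup>+x. ennreal (\<bar>f x\<bar> powr Q) \<partial>weight_measure a) \<le> ennreal (C * J powr Q)"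
    using strong_type_bound[OF a Q1 Qn] by blast
  show ?thesis
  proof
    show "C powr (1 / Q) * s > 0" using C s by simp
    fix f :: "'a \<Rightarrow> real" and g X
    assume C1: "C1_function f g X" and XE: "X \<inter> E = {}"
    interpret C1_function f g X by (rule C1)
    define I where "I = enn2real (\<integral>\<^sup>+x. ennreal (\<bar>f x\<bar> powr q * \<delta> x powr (a - n)) \<partial>lborel)"
    define J where "J = enn2real (\<integral>\<^sup>+x. ennreal (norm (g x) powr p * \<delta> x powr \<beta>) \<partial>lborel)"
    have "(\<integral>\<^sup>+x. ennreal (\<bar>f x\<bar> powr q * \<delta> x powr (a - n)) \<partial>lborel) < \<infinity>"
      using p supp compact_X XE
      by (intro nn_integral_powr_dist_finite[where X = X] continuous_intros cont_f) auto
    then have I: "(\<integral>\<^sup>+x. ennreal (\<bar>f x\<bar> powr q * \<delta> x powr (a - n)) \<partial>lborel) = ennreal I"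
      by (simp add: I_def)
    have "(\<integral>\<^sup>+x. ennreal (norm (g x) powr p * \<delta> x powr \<beta>) \<partial>lborel) < \<infinity>"
      using p gradient_supp compact_X XE
      by (intro nn_integral_powr_dist_finite[where X = X] continuous_intros cont_g) auto
    then have J: "(\<integral>\<^sup>+x. ennreal (norm (g x) powr p * \<delta> x powr \<beta>) \<partial>lborel) = ennreal J"
      by (simp add: J_def)
    have nonneg: "0 \<le> I" "0 \<le> J" by (auto simp: I_def J_def)
    have "I powr (1 / q) \<le> C powr (1 / Q) * s * J powr (1 / p)"
    proof (cases "I = 0")
      case False
      then have Ipos: "I > 0" using nonneg by simp
      define B where "B = s * (J powr (1 / p) * I powr (1 - 1 / p))"
      have B: "B \<ge> 0" using s by (simp add: B_def)
      have "ennreal I \<le> ennreal (C * B powr Q)"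
      proof (cases "p = 1")
        case True
        then have [simp]: "s = 1" "Q = q" by (auto simp: s_def Q_def)
        have "(\<integral>\<^sup>+x. ennreal (\<bar>f x\<bar> powr Q) \<partial>weight_measure a) \<le> ennreal (C * B powr Q)"
          using \<gamma> J True nonneg Ipos by (intro C(2)[OF C1 XE B]) (simp add: B_def)
        then show ?thesis using I unfolding nn_integral_weight_measure[OF C1 XE] by simp
      next
        case False
        then have "p > 1" using p by simp
        then have "s > 1" using p by (simp add: s_def)
        define F where "F x = max 0 (f x) powr s - max 0 (- f x) powr s" for x
        define H where "H x = (s * \<bar>f x\<bar> powr (s - 1)) *\<^sub>R g x" for x
        have F: "C1_function F H X" "\<bar>F x\<bar> = \<bar>f x\<bar> powr s" for x
          unfolding F_def H_def using signed_power[OF \<open>s > 1\<close>] by auto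
        have "(\<integral>\<^sup>+x. ennreal (\<bar>F x\<bar> powr Q) \<partial>weight_measure a) \<le> ennreal (C * B powr Q)"
          unfolding B_def H_def
        proof (rule C(2)[OF F(1) XE])
          show "(\<integral>\<^sup>+y. ennreal (norm (H y) * \<delta> y powr (a / Q - n + 1)) \<partial>lborel) \<le> ennreal (s * (J powr (1 / p) * I powr (1 - 1 / p)))"
            unfolding H_def
            by (rule gradient_Holder[OF \<open>p > 1\<close> p(2) C1 XE s_def \<gamma>]) (use I J nonneg Ipos in auto)
        qed (use B in \<open>simp add: B_def\<close>)
        then show ?thesis using I unfolding nn_integral_weight_measure[OF F(1) XE] unfolding F(2) powr_powr sQ by simp
      qed
      then have "I \<le> C * B powr Q" using C by (subst (asm) ennreal_le_iff) auto
      then have "I powr (1 / Q) \<le> (C * B powr Q) powr (1 / Q)" using nonneg Q1 by (intro powr_mono2) auto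
      also have "\<dots> = C powr (1 / Q) * B" using C B Q1 by (simp add: powr_mult powr_powr)
      also have "I powr (1 / Q) = I powr (1 / q) * I powr (1 - 1 / p)" unfolding invQ by (rule powr_add)
      finally have "I powr (1 / q) * I powr (1 - 1 / p) \<le> (C powr (1 / Q) * s * J powr (1 / p)) * I powr (1 - 1 / p)"
        by (simp add: B_def ac_simps)
      then show ?thesis using Ipos by simp
    qed (use C s in simp)
    then show "enn2real (\<integral>\<^sup>+x. ennreal (\<bar>f x\<bar> powr q * \<delta> x powr (a - n)) \<partial>lborel) powr (1 / q)
      \<le> C powr (1 / Q) * s * enn2real (\<integral>\<^sup>+x. ennreal (norm (g x) powr p * \<delta> x powr \<beta>) \<partial>lborel) powr (1 / p)"
      by (simp add: I_def J_def)
  qed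
qed

end

section \<open>Open sets and test functions\<close>

text \<open>
  A point of the complement nearest to \<open>x\<close> is a limit of points of the segment to \<open>x\<close>, which are closer to
  \<open>x\<close> and so belong to \<open>G\<close>.
\<close>

lemma infdist_frontier_eq:
  fixes G :: "'a::euclidean_space set"
  assumes "open G" "G \<noteq> UNIV" "x \<in> G"
  shows "infdist x (frontier G) = infdist x (- G)"
proof -
  have cl: "closed (- G)" and ne: "- G \<noteq> {}" using assms by auto
  have fr: "frontier G = closure G - G" using assms by (simp add: frontier_def interior_open)
  obtain z where z: "z \<in> - G" "infdist x (- G) = dist x z"
    using infdist_attains_inf[OF cl ne] by blast
  have "z \<in> closure G"
    unfolding closure_approachable
  proof (intro allI impI)
    fix e :: real assume "e > 0"
    have xz: "dist x z > 0" using z assms by auto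
    define t where "t = min (1/2) (e / (2 * dist x z))"
    have t: "0 < t" "t < 1" using xz \<open>e > 0\<close> by (auto simp: t_def)
    let ?y = "z + t *\<^sub>R (x - z)"
    have "x - ?y = (1 - t) *\<^sub>R (x - z)" by (simp add: algebra_simps)
    then have "dist x ?y = (1 - t) * dist x z" using t by (simp add: dist_norm)
    also have "\<dots> < dist x z" using t xz by simp
    finally have "?y \<in> G" using z infdist_le[of ?y "- G" x] by force
    moreover have "dist ?y z < e"
    proof -
      have "dist ?y z = t * dist x z" using t by (simp add: dist_norm)
      also have "\<dots> \<le> e / (2 * dist x z) * dist x z" using xz by (intro mult_right_mono) (auto simp: t_def)
      also have "\<dots> < e" using xz \<open>e > 0\<close> by simp
      finally show ?thesis .
    qed
    ultimately show "\<exists>y\<in>G. dist y z < e" by blast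
  qed
  then have zf: "z \<in> frontier G" using z fr by auto
  show ?thesis
  proof (rule antisym)
    show "infdist x (frontier G) \<le> infdist x (- G)" using infdist_le[OF zf] z by simp
    show "infdist x (- G) \<le> infdist x (frontier G)"
      using zf fr by (intro infdist_mono) auto
  qed
qed

lemma C1_function_test_function:
  fixes f :: "real^'n \<Rightarrow> real"
  assumes "f \<in> test_functions G"
  shows "C1_function f (gradient f) (closure {x. f x \<noteq> 0})"
proof
  have "times_differentiable (Suc 0) f" using assms by (auto simp: test_functions_def smooth_def)
  then have diff: "f differentiable (at x)" and cont: "continuous_on UNIV (\<lambda>x. frechet_derivative f (at x) v)" for x v
    by auto
  show "(f has_derivative (\<lambda>v. gradient f x \<bullet> v)) (at x)" for x
  proof -
    have D: "(f has_derivative frechet_derivative f (at x)) (at x)"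
      using diff by (simp add: frechet_derivative_works)
    then have lin: "linear (frechet_derivative f (at x))"
      by (rule has_derivative_linear)
    have "frechet_derivative f (at x) v = gradient f x \<bullet> v" for v
    proof -
      have "frechet_derivative f (at x) v = frechet_derivative f (at x) (\<Sum>i\<in>UNIV. v $ i *\<^sub>R axis i 1)"
        using basis_expansion[of v] by (simp add: scalar_mult_eq_scaleR)
      also have "\<dots> = (\<Sum>i\<in>UNIV. v $ i * frechet_derivative f (at x) (axis i 1))"
        using lin by (simp add: linear_sum linear_cmul)
      finally show ?thesis by (simp add: gradient_def inner_vec_def mult.commute)
    qed
    then show ?thesis using D by presburger
  qed
  show "continuous_on UNIV (gradient f)"
    unfolding gradient_def by (intro continuous_on_vec_lambda cont)
  show "compact (closure {x. f x \<noteq> 0})" using assms by (simp add: test_functions_def)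
  show "f x = 0" if "x \<notin> closure {x. f x \<noteq> 0}" for x
    using that closure_subset[of "{x. f x \<noteq> 0}"] by auto
qed

theorem theorem4p2:
  fixes G :: "(real^'n) set" and p q \<beta> :: real
  assumes "CARD('n) \<ge> 2"
    and "1 \<le> p" and "p \<le> q"
    and "p < real CARD('n)" and "q \<le> real CARD('n) * p / (real CARD('n) - p)"
    and "open G" and "G \<noteq> {}" and "frontier G \<noteq> {}"
    and "upper_assouad_dim (- G) < min (q / p * (real CARD('n) - p + \<beta>)) (real CARD('n) - 1)"
  shows "hardy_sobolev q p \<beta> G"
proof -
  let ?n = "real CARD('n)"
  have GU: "G \<noteq> UNIV" using \<open>frontier G \<noteq> {}\<close> by auto
  obtain d K where d: "0 \<le> d" "d < min (q / p * (?n - p + \<beta>)) (?n - 1)" "0 < K" "assouad_cover (- G) d K"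
    by (rule upper_assouad_dim_less_imp_cover[OF assms(9)])
  interpret thin_set "- G" d K ?n
  proof
    show "?n = real DIM(real^'n)" by simp
    show "closed (- G)" using \<open>open G\<close> by (simp add: closed_def)
    show "- G \<noteq> {}" using GU by blast
  qed (use d in simp_all)
  obtain C where C: "C > 0"
    "\<And>f g X. C1_function f g X \<Longrightarrow> X \<inter> - G = {} \<Longrightarrow>
      enn2real (\<integral>\<^sup>+x. ennreal (\<bar>f x\<bar> powr q * infdist x (- G) powr (q / p * (?n - p + \<beta>) - ?n)) \<partial>lborel) powr (1 / q)
      \<le> C * enn2real (\<integral>\<^sup>+x. ennreal (norm (g x) powr p * infdist x (- G) powr \<beta>) \<partial>lborel) powr (1 / p)"
    using hardy_sobolev_C1[of p q \<beta>] assms d by auto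
  show ?thesis unfolding hardy_sobolev_def
  proof (intro exI[of _ C] conjI ballI)
    show "C > 0" by fact
    fix f assume f: "f \<in> test_functions G"
    let ?X = "closure {x. f x \<noteq> 0}"
    interpret C1_function f "gradient f" ?X by (rule C1_function_test_function[OF f])
    have XG: "?X \<subseteq> G" using f by (simp add: test_functions_def)
    have LINT: "(LINT x:G|lborel. u x powr r * infdist x (frontier G) powr k)
       = enn2real (\<integral>\<^sup>+x. ennreal (u x powr r * infdist x (- G) powr k) \<partial>lborel)"
      if [measurable]: "u \<in> borel_measurable borel" and "\<And>x. x \<notin> G \<Longrightarrow> u x = 0" for u r k
    proof -
      have "(LINT x:G|lborel. u x powr r * infdist x (frontier G) powr k)
        = (\<integral>x. u x powr r * infdist x (- G) powr k \<partial>lborel)"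
        unfolding set_lebesgue_integral_def
        using that(2) infdist_frontier_eq[OF \<open>open G\<close> GU]
        by (intro Bochner_Integration.integral_cong) (auto simp: indicator_def)
      also have "\<dots> = enn2real (\<integral>\<^sup>+x. ennreal (u x powr r * infdist x (- G) powr k) \<partial>lborel)"
        by (intro integral_eq_nn_integral) auto
      finally show ?thesis .
    qed
    have "f x = 0" "gradient f x = 0" if "x \<notin> G" for x
      using that XG by (blast intro: supp gradient_supp)+
    then have LINT_f: "(LINT x:G|lborel. \<bar>f x\<bar> powr q * infdist x (frontier G) powr k)
         = enn2real (\<integral>\<^sup>+x. ennreal (\<bar>f x\<bar> powr q * infdist x (- G) powr k) \<partial>lborel)"
      and LINT_gradient: "(LINT x:G|lborel. norm (gradient f x) powr p * infdist x (frontier G) powr k)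
         = enn2real (\<integral>\<^sup>+x. ennreal (norm (gradient f x) powr p * infdist x (- G) powr k) \<partial>lborel)" for k
      by (intro LINT; simp)+
    have "?X \<inter> - G = {}" using XG by blast
    then show "(LINT x:G|lborel. \<bar>f x\<bar> powr q * infdist x (frontier G) powr (q / p * (?n - p + \<beta>) - ?n)) powr (1 / q)
       \<le> C * (LINT x:G|lborel. norm (gradient f x) powr p * infdist x (frontier G) powr \<beta>) powr (1 / p)"
      unfolding LINT_f LINT_gradient by (rule C(2)[OF C1_function_axioms])
  qed
qed

end
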